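(* Let $s\in(0,\infty)$. There is a positive constant $C_n$ depending only on $n$ such that, for any nonzero function $f\in H^2(\mathbb R^n)\cap B^{-s}_{\infty,\infty}(\mathbb R^n)$ and any $p\in\left(2+\frac2s,2+\frac4s\right)$, the following interpolation inequality holds: $$\|f\|_p\le C_{n,p,s}\,\|f\|_{B^{-s}_{\infty,\infty}}^{1-\frac2p}\,\|f\|_{H^1}^{\frac4p-s(1-\frac2p)}\,\|f\|_{H^2}^{s(1-\frac2p)-\frac2p},$$ where $$C_{n,p,s}=C_n\max\left\{\frac{1}{2^{s(1-\frac2p)-\frac2p}-1},\ \frac{1}{1-2^{s(1-\frac2p)-\frac4p}}\right\}.$$
   Context: $\|\cdot\|_p$ denotes the norm of $L^p(\mathbb R^n)$. Besov spaces: fix nonnegative radial Schwartz functions $\chi,\phi$ on $\mathbb R^n$ supported in $\{|\xi|\le\frac43\}$ and $\{\frac34\le|\xi|\le\frac83\}$ respectively, with $\chi(\xi)+\sum_{j\ge0}\phi(2^{-j}\xi)=1$ for all $\xi\in\mathbb R^n$. Define the Fourier multipliers $\Delta_{-1}f=\chi(D)f$ and $\Delta_jf=\phi(2^{-j}D)f$ for $j\ge0$. For $\sigma\in\mathbb R$, the inhomogeneous Besov norm is $\|f\|_{B^\sigma_{\infty,\infty}}=\sup_{j\ge-1}2^{j\sigma}\|\Delta_jf\|_{L^\infty}$. The functions $\chi,\phi$ are fixed once and for all. *)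

theory Defs
  imports "HOL-Analysis.Analysis" "HOL-Probability.Essential_Supremum"
begin

section \<open>Lebesgue spaces\<close>

text \<open>
  Elements of $L^p(\mathbb{R}^n)$ are represented by Lebesgue measurable functions
  \<^typ>\<open>(real^'n) \<Rightarrow> complex\<close>; everything below only depends on the class modulo null sets.
  \<open>Lp_norm p f\<close> is meaningful only together with \<open>in_Lp p f\<close>, since the Bochner integral of a
  non-integrable function is 0.
\<close>

definition in_Lp :: "real \<Rightarrow> (real^'n \<Rightarrow> complex) \<Rightarrow> bool" where
  "in_Lp p f \<longleftrightarrow>
     f \<in> borel_measurable lebesgue \<and> integrable lebesgue (\<lambda>x. norm (f x) powr p)"

definition Lp_norm :: "real \<Rightarrow> (real^'n \<Rightarrow> complex) \<Rightarrow> real" where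
  "Lp_norm p f = (\<integral>x. norm (f x) powr p \<partial>lebesgue) powr (1 / p)"

definition Linf_norm :: "(real^'n \<Rightarrow> complex) \<Rightarrow> ennreal" where
  "Linf_norm f = esssup lebesgue (\<lambda>x. ennreal (norm (f x)))"


section \<open>Fourier transform\<close>

text \<open>Unitary normalization, with kernel $(2\pi)^{-n/2} e^{-i x\cdot\xi}$.\<close>

definition fourier_L1 :: "(real^'n \<Rightarrow> complex) \<Rightarrow> real^'n \<Rightarrow> complex" where
  "fourier_L1 f \<xi> =
     complex_of_real ((2 * pi) powr (- real CARD('n) / 2)) *
     (\<integral>x. cis (- (x \<bullet> \<xi>)) * f x \<partial>lebesgue)"

definition inv_fourier_L1 :: "(real^'n \<Rightarrow> complex) \<Rightarrow> real^'n \<Rightarrow> complex" where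
  "inv_fourier_L1 g x =
     complex_of_real ((2 * pi) powr (- real CARD('n) / 2)) *
     (\<integral>\<xi>. cis (x \<bullet> \<xi>) * g \<xi> \<partial>lebesgue)"

text \<open>
  The Fourier--Plancherel transform of $f \in L^2$ is the $L^2$ limit, as $R \to \infty$, of the
  Fourier integrals of the truncations $f 1_{|x| \le R}$, which belong to $L^1 \cap L^2$. By
  Plancherel's theorem it exists, and it is unique up to a null set; \<open>fourier_L2\<close> picks a
  representative.
\<close>

definition is_fourier_L2 :: "(real^'n \<Rightarrow> complex) \<Rightarrow> (real^'n \<Rightarrow> complex) \<Rightarrow> bool" where
  "is_fourier_L2 f g \<longleftrightarrow> in_Lp 2 g \<and>
     ((\<lambda>R::real. \<integral>\<^sup>+\<xi>. ennreal ((norm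
         (fourier_L1 (\<lambda>x. if norm x \<le> R then f x else 0) \<xi> - g \<xi>))\<^sup>2) \<partial>lebesgue)
       \<longlongrightarrow> 0) at_top"

definition fourier_L2 :: "(real^'n \<Rightarrow> complex) \<Rightarrow> real^'n \<Rightarrow> complex" where
  "fourier_L2 f = (SOME g. is_fourier_L2 f g)"

text \<open>
  The multiplier $m(D)f = \mathcal{F}^{-1}(m \hat f)$ for $f \in L^2$. It is only used for bounded
  compactly supported symbols $m$, for which $m \hat f \in L^1$.
\<close>

definition fourier_multiplier ::
    "(real^'n \<Rightarrow> real) \<Rightarrow> (real^'n \<Rightarrow> complex) \<Rightarrow> real^'n \<Rightarrow> complex" where
  "fourier_multiplier m f =
     inv_fourier_L1 (\<lambda>\<xi>. complex_of_real (m \<xi>) * fourier_L2 f \<xi>)"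


section \<open>Sobolev spaces of nonnegative integer order\<close>

definition in_H :: "nat \<Rightarrow> (real^'n \<Rightarrow> complex) \<Rightarrow> bool" where
  "in_H k f \<longleftrightarrow> in_Lp 2 f \<and>
     integrable lebesgue (\<lambda>\<xi>. (1 + (norm \<xi>)\<^sup>2) ^ k * (norm (fourier_L2 f \<xi>))\<^sup>2)"

definition H_norm :: "nat \<Rightarrow> (real^'n \<Rightarrow> complex) \<Rightarrow> real" where
  "H_norm k f =
     sqrt (\<integral>\<xi>. (1 + (norm \<xi>)\<^sup>2) ^ k * (norm (fourier_L2 f \<xi>))\<^sup>2 \<partial>lebesgue)"


section \<open>Schwartz functions\<close>

definition partial_deriv :: "'n \<Rightarrow> (real^'n \<Rightarrow> real) \<Rightarrow> real^'n \<Rightarrow> real" where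
  "partial_deriv i f x = frechet_derivative f (at x) (axis i 1)"

text \<open>Iterated partial derivatives, in the directions given by a list of coordinates.\<close>

definition partial_derivs :: "'n list \<Rightarrow> (real^'n \<Rightarrow> real) \<Rightarrow> real^'n \<Rightarrow> real" where
  "partial_derivs is f = foldr partial_deriv is f"

text \<open>The first conjunct says that $f$ is $C^\infty$.\<close>

definition schwartz :: "(real^'n \<Rightarrow> real) \<Rightarrow> bool" where
  "schwartz f \<longleftrightarrow>
     (\<forall>is x. partial_derivs is f differentiable (at x)) \<and>
     (\<forall>is k. bounded (range (\<lambda>x. norm x ^ k * partial_derivs is f x)))"


section \<open>Littlewood--Paley decomposition and Besov norms\<close>

definition radial :: "(real^'n \<Rightarrow> real) \<Rightarrow> bool" where
  "radial f \<longleftrightarrow> (\<forall>x y. norm x = norm y \<longrightarrow> f x = f y)"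

definition dyadic_partition :: "(real^'n \<Rightarrow> real) \<Rightarrow> (real^'n \<Rightarrow> real) \<Rightarrow> bool" where
  "dyadic_partition chi \<phi> \<longleftrightarrow>
     schwartz chi \<and> radial chi \<and> (\<forall>\<xi>. 0 \<le> chi \<xi>) \<and>
     schwartz \<phi> \<and> radial \<phi> \<and> (\<forall>\<xi>. 0 \<le> \<phi> \<xi>) \<and>
     closure {\<xi>. chi \<xi> \<noteq> 0} \<subseteq> {\<xi>. norm \<xi> \<le> 4 / 3} \<and>
     closure {\<xi>. \<phi> \<xi> \<noteq> 0} \<subseteq> {\<xi>. 3 / 4 \<le> norm \<xi> \<and> norm \<xi> \<le> 8 / 3} \<and>
     (\<forall>\<xi>. summable (\<lambda>j::nat. \<phi> ((1 / 2 ^ j) *\<^sub>R \<xi>)) \<and>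
          chi \<xi> + (\<Sum>j::nat. \<phi> ((1 / 2 ^ j) *\<^sub>R \<xi>)) = 1)"

text \<open>The block $\Delta_j$, for integers $j \ge -1$.\<close>

definition LP_block :: "(real^'n \<Rightarrow> real) \<Rightarrow> (real^'n \<Rightarrow> real) \<Rightarrow> int \<Rightarrow>
    (real^'n \<Rightarrow> complex) \<Rightarrow> real^'n \<Rightarrow> complex" where
  "LP_block chi \<phi> j f =
     (if j = -1 then fourier_multiplier chi f
      else fourier_multiplier (\<lambda>\<xi>. \<phi> ((2 powr (- real_of_int j)) *\<^sub>R \<xi>)) f)"

text \<open>
  The norm of $B^\sigma_{\infty,\infty}$ of a function $f \in L^2$; such an $f$ belongs to
  $B^\sigma_{\infty,\infty}$ iff the value is finite.
\<close>

definition besov_norm :: "(real^'n \<Rightarrow> real) \<Rightarrow> (real^'n \<Rightarrow> real) \<Rightarrow> real \<Rightarrow>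
    (real^'n \<Rightarrow> complex) \<Rightarrow> ennreal" where
  "besov_norm chi \<phi> \<sigma> f =
     (SUP j\<in>{-1..}. ennreal (2 powr (real_of_int j * \<sigma>)) * Linf_norm (LP_block chi \<phi> j f))"

end

theory Submission
  imports Defs "HOL-Probability.Characteristic_Functions"
begin

text \<open>
  Write \<open>\<Delta>\<^sub>j\<close> for the dyadic blocks, \<open>B\<close> for the Besov norm, and \<open>\<theta> = 1 - 2/p\<close>. The heart of the proof is an estimate
  for a single block. Its supremum is at most \<open>2\<^sup>j\<^sup>s B\<close> by definition of \<open>B\<close>, and since its frequencies have size about
  \<open>2\<^sup>j\<close>, its \<open>L\<^sup>2\<close> norm is at most a constant times \<open>2\<^sup>-\<^sup>j\<^sup>k \<parallel>f\<parallel>\<close> with the norm of \<open>H\<^sup>k\<close>, for \<open>k = 1\<close> and for \<open>k = 2\<close>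
  (\<open>LP_block_Linf_bound\<close>, \<open>LP_block_L2_bound\<close>). Interpolation between \<open>L\<^sup>2\<close> and \<open>L\<^sup>\<infinity>\<close> bounds the \<open>L\<^sup>p\<close> norm of the block
  by a constant times \<open>B powr \<theta>\<close> times each of two geometric sequences in \<open>j\<close> (\<open>LP_block_Lp_bound\<close>): one with exponent
  \<open>a = s \<theta> - 2/p\<close>, carrying the \<open>H\<^sup>1\<close> norm, and one with exponent \<open>-b = s \<theta> - 4/p\<close>, carrying the \<open>H\<^sup>2\<close> norm. The range
  allowed for \<open>p\<close> says exactly that \<open>a\<close> and \<open>b\<close> are positive. Using the first sequence up to the frequency at which the
  two agree, \<open>2\<^sup>j\<close> being the quotient of the \<open>H\<^sup>2\<close> and \<open>H\<^sup>1\<close> norms, and the second beyond it, the sum over all blocks is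
  bounded by the product of norms in the statement (\<open>two_sided_geometric_sum_le\<close>); the two reciprocals in the constant
  are, up to factors at most two, the sums of the two geometric series.

  To conclude for \<open>f\<close> itself, the partial sums of its blocks converge to \<open>f\<close> in \<open>L\<^sup>2\<close>
  (\<open>LP_partial_sums_converge_L2\<close>), hence almost everywhere along a subsequence, and Fatou's lemma transfers the bound on
  the sum of the \<open>L\<^sup>p\<close> norms to \<open>f\<close> (\<open>Lp_norm_Fatou\<close>). This argument also proves that \<open>f\<close> belongs to \<open>L\<^sup>p\<close>.

  The remaining work is the Fourier theory of \<open>L\<^sup>2\<close>. Plancherel's identity on \<open>L\<^sup>1 \<inter> L\<^sup>2\<close> follows from Gaussian
  regularization (\<open>gauss_weighted_Plancherel\<close>, \<open>Plancherel_L1_L2\<close>). It implies that the transform of an \<open>L\<^sup>2\<close> function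
  exists (\<open>is_fourier_L2_fourier_L2\<close>) and, together with duality, that inverting an approximation \<open>v\<close> of the transform of
  \<open>f\<close> reproduces \<open>f\<close> with an error no larger than that of \<open>v\<close> (\<open>inv_fourier_L1_approx\<close>).
\<close>

section \<open>Lebesgue spaces: Minkowski and Fatou\<close>

lemma Lp_norm_nonneg: "0 \<le> Lp_norm p f"
  by (simp add: Lp_norm_def)

lemma Lp_norm_powr:
  assumes "p > 0"
  shows "Lp_norm p f powr p = (\<integral>x. norm (f x) powr p \<partial>lebesgue)"
  using assms by (simp add: Lp_norm_def powr_powr)

text \<open>
  The two-way bridge to nonnegative integrals: this lemma reads \<open>Lp_norm\<close> as such an integral, and
  \<open>Lp_norm_leI\<close> recovers membership in \<open>L\<^sup>p\<close> and the norm bound simultaneously. Comparison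
  and Fatou's lemma can then be applied without prior integrability arguments.
\<close>

lemma nn_integral_powr_eq_Lp_norm:
  assumes "p > 0" "in_Lp p f"
  shows "(\<integral>\<^sup>+x. ennreal (norm (f x) powr p) \<partial>lebesgue) = ennreal (Lp_norm p f powr p)"
  using assms by (subst nn_integral_eq_integral) (auto simp: in_Lp_def Lp_norm_powr)

lemma Lp_norm_leI:
  assumes "p > 0" "C \<ge> 0" and [measurable]: "f \<in> borel_measurable lebesgue"
    and le: "(\<integral>\<^sup>+x. ennreal (norm (f x) powr p) \<partial>lebesgue) \<le> ennreal (C powr p)"
  shows "in_Lp p f" and "Lp_norm p f \<le> C"
proof -
  have int: "integrable lebesgue (\<lambda>x. norm (f x) powr p)"
    by (rule integrableI_bounded) (use le in \<open>auto intro: order.strict_trans1\<close>)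
  then show *: "in_Lp p f"
    by (simp add: in_Lp_def)
  have "Lp_norm p f powr p \<le> C powr p"
    using le nn_integral_powr_eq_Lp_norm[OF \<open>p > 0\<close> *] by simp
  then show "Lp_norm p f \<le> C"
    using assms(1,2) Lp_norm_nonneg powr_less_mono2 by (metis not_le)
qed

lemma in_Lp_2_iff:
  "in_Lp 2 f \<longleftrightarrow> f \<in> borel_measurable lebesgue \<and> integrable lebesgue (\<lambda>x. (norm (f x))\<^sup>2)"
  by (simp add: in_Lp_def)

lemma Lp_norm_2_power2: "(Lp_norm 2 f)\<^sup>2 = (\<integral>x. (norm (f x))\<^sup>2 \<partial>lebesgue)"
  using Lp_norm_powr[of 2 f] by (simp add: Lp_norm_nonneg)

lemma nn_integral_power2_eq_Lp_norm:
  assumes "in_Lp 2 f"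
  shows "(\<integral>\<^sup>+x. ennreal ((norm (f x))\<^sup>2) \<partial>lebesgue) = ennreal ((Lp_norm 2 f)\<^sup>2)"
  using nn_integral_powr_eq_Lp_norm[OF _ assms] by (simp add: Lp_norm_nonneg)

lemma L2_norm_leI:
  assumes "C \<ge> 0" "f \<in> borel_measurable lebesgue"
    and "(\<integral>\<^sup>+x. ennreal ((norm (f x))\<^sup>2) \<partial>lebesgue) \<le> ennreal (C\<^sup>2)"
  shows "in_Lp 2 f" and "Lp_norm 2 f \<le> C"
  using Lp_norm_leI[of 2 C f] assms by auto

lemma in_Lp_mono:
  assumes "p > 0" "in_Lp p g" "f \<in> borel_measurable lebesgue"
    and "AE x in lebesgue. norm (f x) \<le> norm (g x)"
  shows "in_Lp p f" and "Lp_norm p f \<le> Lp_norm p g"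
proof -
  have "(\<integral>\<^sup>+x. ennreal (norm (f x) powr p) \<partial>lebesgue) \<le> (\<integral>\<^sup>+x. ennreal (norm (g x) powr p) \<partial>lebesgue)"
    by (rule nn_integral_mono_AE) (use assms(1,4) in \<open>auto elim!: eventually_mono intro!: powr_mono2\<close>)
  then have le: "(\<integral>\<^sup>+x. ennreal (norm (f x) powr p) \<partial>lebesgue) \<le> ennreal (Lp_norm p g powr p)"
    using assms by (simp add: nn_integral_powr_eq_Lp_norm)
  show "in_Lp p f" "Lp_norm p f \<le> Lp_norm p g"
    using Lp_norm_leI[OF assms(1) Lp_norm_nonneg assms(3) le] by auto
qed

lemma in_Lp_uminus: "in_Lp p (\<lambda>x. - f x) \<longleftrightarrow> in_Lp p f"
proof -
  have "(\<lambda>x. - f x) \<in> borel_measurable lebesgue \<longleftrightarrow> f \<in> borel_measurable lebesgue"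
    using borel_measurable_uminus_eq by blast
  then show ?thesis
    by (simp add: in_Lp_def)
qed

lemma Lp_norm_uminus: "Lp_norm p (\<lambda>x. - f x) = Lp_norm p f"
  by (simp add: Lp_norm_def)

lemma Lp_norm_minus_commute: "Lp_norm p (\<lambda>x. f x - g x) = Lp_norm p (\<lambda>x. g x - f x)"
  by (simp add: Lp_norm_def norm_minus_commute)

text \<open>
  Convexity of \<open>u \<mapsto> u powr p\<close> up to the boundary point \<open>0\<close>, where it reduces to \<open>t powr p \<le> t\<close>.
\<close>

lemma convex_powr_nonneg:
  fixes x y t :: real
  assumes p: "p \<ge> 1" and "0 \<le> x" "0 \<le> y" and t: "0 \<le> t" "t \<le> 1"
  shows "((1 - t) * x + t * y) powr p \<le> (1 - t) * x powr p + t * y powr p"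
proof -
  have le: "u powr p \<le> u" if "0 \<le> u" "u \<le> 1" for u :: real
    using powr_mono'[of 1 p u] that p by simp
  consider "x = 0" | "y = 0" | "0 < x" "0 < y"
    using assms by linarith
  then show ?thesis
  proof cases
    case 1
    then show ?thesis
      using le[of t] t \<open>0 \<le> y\<close> by (simp add: powr_mult mult_right_mono)
  next
    case 2
    then show ?thesis
      using le[of "1 - t"] t \<open>0 \<le> x\<close> by (simp add: powr_mult mult_right_mono)
  next
    case 3
    then show ?thesis
      using convex_onD[OF powr_convex[OF p], of t x y] t by simp
  qed
qed

text \<open>
  The pointwise form of Minkowski's inequality: \<open>(u + v) / (A + B)\<close> is the convex combination of
  \<open>u / A\<close> and \<open>v / B\<close> with weights \<open>A / (A + B)\<close> and \<open>B / (A + B)\<close>. When \<open>A\<close> and \<open>B\<close> bound the norms of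
  the two summands, integrating the right-hand side gives at most \<open>(A + B) powr p\<close>.
\<close>

lemma powr_convex_weights:
  fixes u v :: real
  assumes "p \<ge> 1" "u \<ge> 0" "v \<ge> 0" "A > 0" "B > 0"
  shows "(u + v) powr p \<le> (A + B) powr p * (A / (A + B) * (u powr p / A powr p) + B / (A + B) * (v powr p / B powr p))"
proof -
  have "((1 - B / (A + B)) * (u / A) + B / (A + B) * (v / B)) powr p
      \<le> (1 - B / (A + B)) * (u / A) powr p + B / (A + B) * (v / B) powr p"
    using assms by (intro convex_powr_nonneg) auto
  moreover have "1 - B / (A + B) = A / (A + B)"
    using assms by (simp add: field_simps)
  moreover have "A / (A + B) * (u / A) + B / (A + B) * (v / B) = (u + v) / (A + B)"
    using assms by (simp add: add_divide_distrib)
  ultimately have "((u + v) / (A + B)) powr p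
      \<le> A / (A + B) * (u powr p / A powr p) + B / (A + B) * (v powr p / B powr p)"
    using assms by (simp add: powr_divide)
  then show ?thesis
    using assms by (simp add: powr_divide field_simps)
qed

lemma Lp_norm_add:
  assumes p: "p \<ge> 1" and f: "in_Lp p f" and g: "in_Lp p g"
  shows "in_Lp p (\<lambda>x. f x + g x)" and "Lp_norm p (\<lambda>x. f x + g x) \<le> Lp_norm p f + Lp_norm p g"
proof -
  have [measurable]: "f \<in> borel_measurable lebesgue" "g \<in> borel_measurable lebesgue"
    using f g by (auto simp: in_Lp_def)
  have int: "integrable lebesgue (\<lambda>x. norm (f x) powr p)" "integrable lebesgue (\<lambda>x. norm (g x) powr p)"
    using f g by (auto simp: in_Lp_def)
  \<comment> \<open>Strict bounds \<open>A\<close>, \<open>B\<close> avoid dividing by a norm that may vanish; they are relaxed at the end.\<close>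
  have *: "in_Lp p (\<lambda>x. f x + g x) \<and> Lp_norm p (\<lambda>x. f x + g x) \<le> A + B"
    if A: "A > Lp_norm p f" and B: "B > Lp_norm p g" for A B
  proof -
    have pos: "A > 0" "B > 0"
      using A B Lp_norm_nonneg le_less_trans by blast+
    define h where "h x = (A + B) powr p *
        (A / (A + B) * (norm (f x) powr p / A powr p) + B / (A + B) * (norm (g x) powr p / B powr p))" for x
    have int_h: "integrable lebesgue h"
      unfolding h_def using int by (intro integrable_mult_right Bochner_Integration.integrable_add integrable_divide) auto
    have h0: "h x \<ge> 0" for x
      using pos by (simp add: h_def)
    have le_h: "norm (f x + g x) powr p \<le> h x" for x
    proof -
      have "norm (f x + g x) powr p \<le> (norm (f x) + norm (g x)) powr p"
        using p by (intro powr_mono2 norm_triangle_ineq) auto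
      also have "\<dots> \<le> h x"
        unfolding h_def using p pos by (intro powr_convex_weights) auto
      finally show ?thesis .
    qed
    have "(\<integral>x. h x \<partial>lebesgue) = (A + B) powr p *
        (A / (A + B) * (Lp_norm p f powr p / A powr p) + B / (A + B) * (Lp_norm p g powr p / B powr p))"
      unfolding h_def using int p by (simp add: Lp_norm_powr)
    also have "\<dots> \<le> (A + B) powr p * (A / (A + B) * 1 + B / (A + B) * 1)"
      using A B pos p by (intro mult_left_mono add_mono) (auto intro!: powr_mono2 simp: Lp_norm_nonneg)
    also have "\<dots> = (A + B) powr p"
      using pos by (simp add: field_simps flip: add_divide_distrib)
    finally have "(\<integral>\<^sup>+x. ennreal (h x) \<partial>lebesgue) \<le> ennreal ((A + B) powr p)"
      using int_h h0 by (subst nn_integral_eq_integral) auto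
    moreover have "(\<integral>\<^sup>+x. ennreal (norm (f x + g x) powr p) \<partial>lebesgue) \<le> (\<integral>\<^sup>+x. ennreal (h x) \<partial>lebesgue)"
      by (intro nn_integral_mono ennreal_leI le_h)
    ultimately show ?thesis
      using Lp_norm_leI[of p "A + B" "\<lambda>x. f x + g x"] p pos by auto
  qed
  show "in_Lp p (\<lambda>x. f x + g x)"
    using *[of "Lp_norm p f + 1" "Lp_norm p g + 1"] by auto
  show "Lp_norm p (\<lambda>x. f x + g x) \<le> Lp_norm p f + Lp_norm p g"
  proof (rule field_le_epsilon)
    fix e :: real assume "e > 0"
    then show "Lp_norm p (\<lambda>x. f x + g x) \<le> Lp_norm p f + Lp_norm p g + e"
      using *[of "Lp_norm p f + e/2" "Lp_norm p g + e/2"] by (auto simp: algebra_simps)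
  qed
qed

lemma Lp_norm_diff:
  assumes "p \<ge> 1" "in_Lp p f" "in_Lp p g"
  shows "in_Lp p (\<lambda>x. f x - g x)" and "Lp_norm p (\<lambda>x. f x - g x) \<le> Lp_norm p f + Lp_norm p g"
  using Lp_norm_add[of p f "\<lambda>x. - g x"] assms by (auto simp: in_Lp_uminus Lp_norm_uminus)

lemma Lp_norm_diff_triangle:
  assumes "p \<ge> 1" "in_Lp p f" "in_Lp p g" "in_Lp p h"
  shows "Lp_norm p (\<lambda>x. f x - h x) \<le> Lp_norm p (\<lambda>x. f x - g x) + Lp_norm p (\<lambda>x. g x - h x)"
  using Lp_norm_add(2)[OF assms(1) Lp_norm_diff(1)[OF assms(1-3)] Lp_norm_diff(1)[OF assms(1,3,4)]] by simp

lemma Lp_norm_triangle_sub: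
  assumes "p \<ge> 1" "in_Lp p f" "in_Lp p g"
  shows "Lp_norm p f \<le> Lp_norm p g + Lp_norm p (\<lambda>x. f x - g x)"
  using Lp_norm_add(2)[OF assms(1,3) Lp_norm_diff(1)[OF assms]] by simp

lemma Lp_norm_sum:
  assumes p: "p \<ge> 1" and "finite I" "\<And>i. i \<in> I \<Longrightarrow> in_Lp p (f i)"
  shows "in_Lp p (\<lambda>x. \<Sum>i\<in>I. f i x) \<and> Lp_norm p (\<lambda>x. \<Sum>i\<in>I. f i x) \<le> (\<Sum>i\<in>I. Lp_norm p (f i))"
  using assms(2,3)
proof (induction I rule: finite_induct)
  case empty
  then show ?case
    using p by (simp add: in_Lp_def Lp_norm_def)
next
  case (insert i I)
  then have "in_Lp p (f i)" "in_Lp p (\<lambda>x. \<Sum>i\<in>I. f i x)"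
      "Lp_norm p (\<lambda>x. \<Sum>i\<in>I. f i x) \<le> (\<Sum>i\<in>I. Lp_norm p (f i))"
    by auto
  then show ?case
    using insert.hyps Lp_norm_add[OF p, of "f i" "\<lambda>x. \<Sum>i\<in>I. f i x"] by fastforce
qed

text \<open>
  Carries a uniform norm bound to an almost everywhere limit, with no convergence in \<open>L\<^sup>p\<close>: the partial sums of
  the Littlewood--Paley expansion are only known to converge in \<open>L\<^sup>2\<close>.
\<close>

lemma Lp_norm_Fatou:
  assumes p: "p > 0" and f: "\<And>n. in_Lp p (f n)" and bd: "\<And>n. Lp_norm p (f n) \<le> C"
    and lim: "AE x in lebesgue. (\<lambda>n. f n x) \<longlonglongrightarrow> g x"
    and [measurable]: "g \<in> borel_measurable lebesgue"
  shows "in_Lp p g" and "Lp_norm p g \<le> C"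
proof -
  have [measurable]: "\<And>n. f n \<in> borel_measurable lebesgue"
    using f by (auto simp: in_Lp_def)
  have C: "C \<ge> 0"
    using Lp_norm_nonneg bd order_trans by blast
  have "(\<integral>\<^sup>+x. ennreal (norm (g x) powr p) \<partial>lebesgue)
      \<le> (\<integral>\<^sup>+x. liminf (\<lambda>n. ennreal (norm (f n x) powr p)) \<partial>lebesgue)"
  proof (rule nn_integral_mono_AE)
    show "AE x in lebesgue. ennreal (norm (g x) powr p) \<le> liminf (\<lambda>n. ennreal (norm (f n x) powr p))"
      using lim
    proof eventually_elim
      case (elim x)
      have "(\<lambda>n. ennreal (norm (f n x) powr p)) \<longlonglongrightarrow> ennreal (norm (g x) powr p)"
        by (intro tendsto_ennrealI tendsto_powr2 tendsto_norm elim tendsto_const) (use p in auto)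
      from lim_imp_Liminf[OF _ this] show ?case
        by simp
    qed
  qed
  also have "\<dots> \<le> liminf (\<lambda>n. \<integral>\<^sup>+x. ennreal (norm (f n x) powr p) \<partial>lebesgue)"
    by (rule nn_integral_liminf) auto
  also have "\<dots> \<le> ennreal (C powr p)"
  proof (rule order_trans[OF Liminf_le_Limsup Limsup_bounded])
    show "\<forall>\<^sub>F n in sequentially. (\<integral>\<^sup>+x. ennreal (norm (f n x) powr p) \<partial>lebesgue) \<le> ennreal (C powr p)"
      using f bd p by (auto simp: nn_integral_powr_eq_Lp_norm Lp_norm_nonneg intro!: always_eventually powr_mono2)
  qed auto
  finally have *: "(\<integral>\<^sup>+x. ennreal (norm (g x) powr p) \<partial>lebesgue) \<le> ennreal (C powr p)" .
  show "in_Lp p g" "Lp_norm p g \<le> C"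
    using Lp_norm_leI[OF p C assms(5) *] by auto
qed

section \<open>Square-integrable functions: completeness, truncation and density\<close>

lemma pred_lebesgue_norm_le [measurable]:
  "Measurable.pred lebesgue (\<lambda>x. norm (x :: 'a :: euclidean_space) \<le> R)"
  by (intro measurable_completion) simp

lemma borel_measurable_lebesgue_continuous:
  "continuous_on UNIV f \<Longrightarrow> f \<in> borel_measurable lebesgue"
  by (intro measurable_completion) (simp add: borel_measurable_continuous_onI)

lemma integrable_mult_L2:
  assumes f: "in_Lp 2 f" and g: "in_Lp 2 g"
  shows "integrable lebesgue (\<lambda>x. f x * g x)"
    and "(\<integral>x. norm (f x * g x) \<partial>lebesgue) \<le> Lp_norm 2 f * Lp_norm 2 g"
proof -
  have [measurable]: "f \<in> borel_measurable lebesgue" "g \<in> borel_measurable lebesgue"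
    using f g by (auto simp: in_Lp_def)
  have "(\<integral>\<^sup>+x. ennreal (norm (f x * g x)) \<partial>lebesgue)\<^sup>2
      \<le> (\<integral>\<^sup>+x. ennreal ((norm (f x))\<^sup>2) \<partial>lebesgue) * (\<integral>\<^sup>+x. ennreal ((norm (g x))\<^sup>2) \<partial>lebesgue)"
    using Cauchy_Schwarz_nn_integral[of "\<lambda>x. ennreal (norm (f x))" lebesgue "\<lambda>x. ennreal (norm (g x))"]
    by (simp add: norm_mult ennreal_mult ennreal_power)
  also have "\<dots> = ennreal ((Lp_norm 2 f)\<^sup>2) * ennreal ((Lp_norm 2 g)\<^sup>2)"
    using f g by (simp add: nn_integral_power2_eq_Lp_norm)
  finally have "(\<integral>\<^sup>+x. ennreal (norm (f x * g x)) \<partial>lebesgue)\<^sup>2 \<le> (ennreal (Lp_norm 2 f * Lp_norm 2 g))\<^sup>2"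
    by (simp add: ennreal_power Lp_norm_nonneg power_mult_distrib ennreal_mult)
  then have le: "(\<integral>\<^sup>+x. ennreal (norm (f x * g x)) \<partial>lebesgue) \<le> ennreal (Lp_norm 2 f * Lp_norm 2 g)"
    using Lp_norm_nonneg[of 2 f] Lp_norm_nonneg[of 2 g]
    by (cases "\<integral>\<^sup>+x. ennreal (norm (f x * g x)) \<partial>lebesgue")
       (auto simp: ennreal_power top_power_ennreal top_unique intro!: ennreal_leI power2_le_imp_le)
  show int: "integrable lebesgue (\<lambda>x. f x * g x)"
    by (rule integrableI_bounded) (use le in \<open>auto intro: order.strict_trans1\<close>)
  show "(\<integral>x. norm (f x * g x) \<partial>lebesgue) \<le> Lp_norm 2 f * Lp_norm 2 g"
    using le nn_integral_eq_integral[OF integrable_norm[OF int]]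
    by (simp add: Lp_norm_nonneg)
qed

lemma L2_null_imp_AE_subseq:
  assumes "\<And>n. in_Lp 2 (u n)" "(\<lambda>n. Lp_norm 2 (u n)) \<longlonglongrightarrow> 0"
  obtains r :: "nat \<Rightarrow> nat" where "strict_mono r" "AE x in lebesgue. (\<lambda>n. u (r n) x) \<longlonglongrightarrow> 0"
proof -
  have "\<exists>r::nat\<Rightarrow>nat. strict_mono r \<and> (AE x in lebesgue. (\<lambda>n. (norm (u (r n) x))\<^sup>2) \<longlonglongrightarrow> 0)"
  proof (rule tendsto_L1_AE_subseq)
    show "integrable lebesgue (\<lambda>x. (norm (u n x))\<^sup>2)" for n
      using assms(1) in_Lp_2_iff by blast
    show "(\<lambda>n. LINT x|lebesgue. norm ((norm (u n x))\<^sup>2)) \<longlonglongrightarrow> 0"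
      using tendsto_power[OF assms(2), of 2] by (simp add: Lp_norm_2_power2)
  qed
  then obtain r :: "nat \<Rightarrow> nat" where r: "strict_mono r"
    and ae: "AE x in lebesgue. (\<lambda>n. (norm (u (r n) x))\<^sup>2) \<longlonglongrightarrow> 0"
    by blast
  from ae have "AE x in lebesgue. (\<lambda>n. u (r n) x) \<longlonglongrightarrow> 0"
  proof eventually_elim
    case (elim x)
    from tendsto_real_sqrt[OF this] have "(\<lambda>n. norm (u (r n) x)) \<longlonglongrightarrow> 0"
      by simp
    then show ?case
      by (simp add: tendsto_norm_zero_iff)
  qed
  with r show thesis
    using that by blast
qed

text \<open>
  Riesz--Fischer. Multiplication by a positive weight \<open>w\<close> in \<open>L\<^sup>2\<close> turns a Cauchy sequence of \<open>L\<^sup>2\<close> into one of \<open>L\<^sup>1\<close>,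
  which has an almost everywhere convergent subsequence; division by \<open>w\<close> gives the pointwise limit of the
  original subsequence, and Fatou shows that it is the limit in norm.
\<close>

lemma L2_complete:
  fixes u :: "nat \<Rightarrow> real^'n \<Rightarrow> complex"
  assumes u: "\<And>n. in_Lp 2 (u n)"
    and Cauchy: "\<And>e. e > 0 \<Longrightarrow> \<exists>N. \<forall>m\<ge>N. \<forall>n\<ge>N. Lp_norm 2 (\<lambda>x. u m x - u n x) < e"
  obtains g where "in_Lp 2 g" "(\<lambda>n. Lp_norm 2 (\<lambda>x. u n x - g x)) \<longlonglongrightarrow> 0"
proof -
  have um[measurable]: "\<And>n. u n \<in> borel_measurable lebesgue"
    using u by (auto simp: in_Lp_def)
  obtain w0 :: "real^'n \<Rightarrow> real" where w0[measurable]: "w0 \<in> borel_measurable lborel"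
    and w0pos: "\<And>x. w0 x > 0" and "integrable lborel w0"
    using sigma_finite_measure.obtain_positive_integrable_function[OF sigma_finite_lborel] by metis
  then have w0int: "integrable lebesgue w0"
    by (simp add: integrable_completion)
  define w where "w x = complex_of_real (sqrt (w0 x))" for x
  have w: "in_Lp 2 w"
    using w0int w0pos less_imp_le[OF w0pos] unfolding in_Lp_2_iff w_def
    by (auto intro!: measurable_completion)
  have w_nz: "w x \<noteq> 0" for x
    using w0pos[of x] by (simp add: w_def)
  have weighted: "\<exists>N. \<forall>i\<ge>N. \<forall>j\<ge>N. LINT x|lebesgue. norm (w x * u i x - w x * u j x) < e" if "e > 0" for e
  proof -
    have K: "Lp_norm 2 w + 1 > 0"
      using Lp_norm_nonneg[of 2 w] by linarith
    then obtain N where N: "\<And>m n. m \<ge> N \<Longrightarrow> n \<ge> N \<Longrightarrow> Lp_norm 2 (\<lambda>x. u m x - u n x) < e / (Lp_norm 2 w + 1)"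
      using Cauchy[of "e / (Lp_norm 2 w + 1)"] \<open>e > 0\<close> by auto
    have "LINT x|lebesgue. norm (w x * u i x - w x * u j x) < e" if "i \<ge> N" "j \<ge> N" for i j
    proof -
      have "LINT x|lebesgue. norm (w x * u i x - w x * u j x) \<le> Lp_norm 2 w * Lp_norm 2 (\<lambda>x. u i x - u j x)"
        using integrable_mult_L2(2)[OF w Lp_norm_diff(1)[OF _ u u], of i j] by (simp add: right_diff_distrib)
      also have "\<dots> \<le> (Lp_norm 2 w + 1) * Lp_norm 2 (\<lambda>x. u i x - u j x)"
        by (intro mult_right_mono) (auto simp: Lp_norm_nonneg)
      also have "\<dots> < e"
        using N[OF that] K by (simp add: field_simps)
      finally show ?thesis .
    qed
    then show ?thesis by blast
  qed
  obtain r where r: "strict_mono r" and ae: "AE x in lebesgue. Cauchy (\<lambda>i. w x * u (r i) x)"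
    using cauchy_L1_AE_cauchy_subseq[OF integrable_mult_L2(1)[OF w u] weighted] by blast
  define g where "g x = lim (\<lambda>i. u (r i) x)" for x
  have [measurable]: "g \<in> borel_measurable lebesgue"
    unfolding g_def[abs_def] by (rule borel_measurable_lim_metric[OF um])
  have lim: "AE x in lebesgue. (\<lambda>i. u (r i) x) \<longlonglongrightarrow> g x"
    using ae
  proof eventually_elim
    case (elim x)
    then obtain l where "(\<lambda>i. w x * u (r i) x) \<longlonglongrightarrow> l"
      using Cauchy_convergent_iff convergent_def by blast
    from tendsto_divide[OF this tendsto_const w_nz[of x]] have *: "(\<lambda>i. u (r i) x) \<longlonglongrightarrow> l / w x"
      using w_nz[of x] by simp
    then show ?case
      using limI[OF *] by (simp add: g_def)
  qed
  have est: "\<exists>N. \<forall>n\<ge>N. in_Lp 2 (\<lambda>x. u n x - g x) \<and> Lp_norm 2 (\<lambda>x. u n x - g x) \<le> e" if "e > 0" for e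
  proof -
    obtain N where N: "\<And>m n. m \<ge> N \<Longrightarrow> n \<ge> N \<Longrightarrow> Lp_norm 2 (\<lambda>x. u m x - u n x) < e"
      using Cauchy[OF \<open>e > 0\<close>] by blast
    have "in_Lp 2 (\<lambda>x. u n x - g x) \<and> Lp_norm 2 (\<lambda>x. u n x - g x) \<le> e" if "n \<ge> N" for n
    proof -
      have diff: "in_Lp 2 (\<lambda>x. u n x - u (r (i + N)) x)" for i
        by (rule Lp_norm_diff(1)[OF _ u u]) simp
      have le: "Lp_norm 2 (\<lambda>x. u n x - u (r (i + N)) x) \<le> e" for i
        using N[OF that, of "r (i + N)"] seq_suble[OF r, of "i + N"] by linarith
      have "AE x in lebesgue. (\<lambda>i. u n x - u (r (i + N)) x) \<longlonglongrightarrow> u n x - g x"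
        using lim
      proof eventually_elim
        case (elim x)
        then show ?case
          by (intro tendsto_diff tendsto_const LIMSEQ_ignore_initial_segment)
      qed
      from Lp_norm_Fatou[OF _ diff le this] show ?thesis
        by simp
    qed
    then show ?thesis by blast
  qed
  obtain N where "in_Lp 2 (\<lambda>x. u N x - g x)"
    using est[of 1] by auto
  from Lp_norm_diff(1)[OF _ u[of N] this] have "in_Lp 2 g"
    by simp
  moreover have "(\<lambda>n. Lp_norm 2 (\<lambda>x. u n x - g x)) \<longlonglongrightarrow> 0"
  proof (rule LIMSEQ_I)
    fix e :: real assume "e > 0"
    then obtain N where "\<forall>n\<ge>N. Lp_norm 2 (\<lambda>x. u n x - g x) \<le> e / 2"
      using est[of "e/2"] by auto
    then have "\<forall>n\<ge>N. norm (Lp_norm 2 (\<lambda>x. u n x - g x) - 0) < e"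
      using \<open>e > 0\<close> by (fastforce simp: Lp_norm_nonneg)
    then show "\<exists>no. \<forall>n\<ge>no. norm (Lp_norm 2 (\<lambda>x. u n x - g x) - 0) < e"
      by blast
  qed
  ultimately show thesis
    using that by blast
qed

text \<open>
  The truncations by which the Fourier--Plancherel transform is defined.
\<close>

definition truncate :: "real \<Rightarrow> (real^'n \<Rightarrow> complex) \<Rightarrow> real^'n \<Rightarrow> complex" where
  "truncate R f x = (if norm x \<le> R then f x else 0)"

lemma measurable_truncate [measurable]:
  "f \<in> borel_measurable lebesgue \<Longrightarrow> truncate R f \<in> borel_measurable lebesgue"
  unfolding truncate_def[abs_def]
  by (rule measurable_If) (use pred_lebesgue_norm_le[of R] in \<open>simp_all add: pred_def\<close>)

lemma in_Lp_truncate: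
  assumes "p > 0" "in_Lp p f"
  shows "in_Lp p (truncate R f)"
proof (rule in_Lp_mono(1)[OF assms])
  show "truncate R f \<in> borel_measurable lebesgue"
    using assms by (intro measurable_truncate) (simp add: in_Lp_def)
qed (simp add: truncate_def)

text \<open>
  Balls have finite measure, and \<open>t \<le> t\<^sup>2 + 1\<close>.
\<close>

lemma integrable_truncate_L2:
  fixes f :: "real^'n \<Rightarrow> complex"
  assumes f: "in_Lp 2 f"
  shows "integrable lebesgue (truncate R f)"
proof (rule Bochner_Integration.integrable_bound)
  have [measurable]: "f \<in> borel_measurable lebesgue"
    using f by (auto simp: in_Lp_def)
  show "integrable lebesgue (\<lambda>x. (norm (f x))\<^sup>2 + indicator (cball 0 R) x)"
    using f lmeasurable_cball[of "0 :: real^'n" R]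
    by (intro Bochner_Integration.integrable_add integrable_real_indicator)
       (auto simp: in_Lp_2_iff fmeasurable_def)
  show "truncate R f \<in> borel_measurable lebesgue"
    by measurable
  have "t \<le> t\<^sup>2 + 1" for t :: real
    using sum_power2_ge_zero[of "t - 1/2" 0] by (simp add: power2_eq_square algebra_simps)
  then show "AE x in lebesgue. norm (truncate R f x) \<le> norm ((norm (f x))\<^sup>2 + indicator (cball 0 R) x :: real)"
    by (auto simp: truncate_def indicator_def)
qed

lemma Lp_norm_truncate_diff_tendsto:
  fixes f :: "real^'n \<Rightarrow> complex"
  assumes f: "in_Lp 2 f"
  shows "((\<lambda>R. Lp_norm 2 (\<lambda>x. truncate R f x - f x)) \<longlongrightarrow> 0) at_top"
proof -
  have [measurable]: "f \<in> borel_measurable lebesgue"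
    using f by (auto simp: in_Lp_def)
  have "((\<lambda>R. \<integral>x. (norm (truncate R f x - f x))\<^sup>2 \<partial>lebesgue) \<longlongrightarrow> (\<integral>x. (0 :: real) \<partial>(lebesgue :: (real^'n) measure))) at_top"
  proof (rule integral_dominated_convergence_at_top[where w = "\<lambda>x. (norm (f x))\<^sup>2"])
    show "integrable lebesgue (\<lambda>x. (norm (f x))\<^sup>2)"
      using f by (simp add: in_Lp_2_iff)
    show "\<forall>\<^sub>F R in at_top. AE x in lebesgue. norm ((norm (truncate R f x - f x))\<^sup>2) \<le> (norm (f x))\<^sup>2"
      by (auto simp: truncate_def)
    show "AE x in lebesgue. ((\<lambda>R. (norm (truncate R f x - f x))\<^sup>2) \<longlongrightarrow> 0) at_top"
    proof (rule AE_I2)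
      fix x
      have "\<forall>\<^sub>F R in at_top. (norm (truncate R f x - f x))\<^sup>2 = 0"
        using eventually_ge_at_top[of "norm x"] by eventually_elim (simp add: truncate_def)
      then show "((\<lambda>R. (norm (truncate R f x - f x))\<^sup>2) \<longlongrightarrow> 0) at_top"
        by (rule tendsto_eventually)
    qed
  qed auto
  from tendsto_real_sqrt[OF this] show ?thesis
    by (simp add: Lp_norm_nonneg flip: Lp_norm_2_power2)
qed

lemma continuous_bounded_support_integrable:
  fixes g :: "'a::euclidean_space \<Rightarrow> complex"
  assumes cont: "continuous_on UNIV g" and bd: "\<And>x. norm (g x) \<le> M" and supp: "\<And>x. norm x > M \<Longrightarrow> g x = 0"
  shows "integrable lborel g" and "integrable lborel (\<lambda>x. (norm (g x))\<^sup>2)"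
proof -
  have [measurable]: "g \<in> borel_measurable borel"
    using cont by (rule borel_measurable_continuous_onI)
  have M: "M \<ge> 0"
    using bd[of 0] norm_ge_zero order_trans by blast
  have int_ind: "integrable lborel (\<lambda>x :: 'a. c * indicator (cball 0 M) x :: real)" for c
    using emeasure_bounded_finite[OF bounded_cball[of "0 :: 'a" M]]
    by (intro integrable_mult_right integrable_real_indicator) auto
  show "integrable lborel g"
  proof (rule Bochner_Integration.integrable_bound[OF int_ind[of M]])
    show "AE x in lborel. norm (g x) \<le> norm (M * indicator (cball 0 M) x)"
      using bd supp M by (auto simp: indicator_def)
  qed measurable
  show "integrable lborel (\<lambda>x. (norm (g x))\<^sup>2)"
  proof (rule Bochner_Integration.integrable_bound[OF int_ind[of "M\<^sup>2"]])
    show "AE x in lborel. norm ((norm (g x))\<^sup>2) \<le> norm (M\<^sup>2 * indicator (cball 0 M) x)"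
      using bd supp M by (auto simp: indicator_def power_mono)
  qed measurable
qed

lemma continuous_bounded_support_L1_L2:
  fixes g :: "real^'n \<Rightarrow> complex"
  assumes cont: "continuous_on UNIV g" and bd: "\<And>x. norm (g x) \<le> M" and supp: "\<And>x. norm x > M \<Longrightarrow> g x = 0"
  shows "integrable lebesgue g" and "in_Lp 2 g"
proof -
  have [measurable]: "g \<in> borel_measurable borel"
    using cont by (rule borel_measurable_continuous_onI)
  show "integrable lebesgue g"
    using continuous_bounded_support_integrable(1)[OF cont bd supp] by (simp add: integrable_completion)
  show "in_Lp 2 g"
    using continuous_bounded_support_integrable(2)[OF cont bd supp] borel_measurable_lebesgue_continuous[OF cont]
    by (simp add: in_Lp_2_iff integrable_completion)
qed

text \<open>
  A measurable function is an almost everywhere limit of continuous functions. For a bounded function of bounded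
  support these can be clamped in value (\<open>cl\<close>) and cut off in space (\<open>\<eta>\<close>) without changing the limit, and
  dominated convergence turns pointwise convergence into convergence in \<open>L\<^sup>2\<close>.
\<close>

lemma continuous_dense_L2_bounded:
  fixes h :: "real^'n \<Rightarrow> complex"
  assumes [measurable]: "h \<in> borel_measurable lebesgue" and "M > 0"
    and bd: "\<And>x. norm (h x) \<le> M" and supp: "\<And>x. norm x > M \<Longrightarrow> h x = 0" and "e > 0"
  obtains g where "continuous_on UNIV g" "\<And>x. norm (g x) \<le> M" "\<And>x. norm x > M + 1 \<Longrightarrow> g x = 0"
    "Lp_norm 2 (\<lambda>x. h x - g x) < e"
proof -
  have "h measurable_on UNIV"
    by (rule lebesgue_measurable_imp_measurable_on) auto
  then obtain N G where N: "negligible N" and G: "\<And>n. continuous_on UNIV (G n)"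
    and lim: "\<And>x. x \<notin> N \<Longrightarrow> (\<lambda>n. G n x) \<longlonglongrightarrow> h x"
    by (auto simp: measurable_on_def)
  define cl :: "complex \<Rightarrow> complex" where "cl z = z / of_real (max 1 (norm z / M))" for z
  define \<eta> :: "real^'n \<Rightarrow> complex" where "\<eta> x = of_real (max 0 (min 1 (M + 1 - norm x)))" for x
  have cl_cont: "continuous_on UNIV cl"
    unfolding cl_def using \<open>M > 0\<close> by (intro continuous_intros) (auto simp: max_def)
  have cl_le: "norm (cl z) \<le> M" for z
    using \<open>M > 0\<close> by (auto simp: cl_def norm_divide max_def field_simps)
  have cl_h: "cl (h x) = h x" for x
    using bd[of x] \<open>M > 0\<close> by (auto simp: cl_def max_def)
  have \<eta>_le: "norm (\<eta> x) \<le> 1" for x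
    by (auto simp: \<eta>_def)
  have \<eta>_h: "\<eta> x * h x = h x" for x
    using supp[of x] by (cases "norm x \<le> M") (auto simp: \<eta>_def)
  define g where "g n x = \<eta> x * cl (G n x)" for n x
  have g_cont: "continuous_on UNIV (g n)" for n
    unfolding g_def \<eta>_def
    by (intro continuous_intros continuous_on_compose2[OF cl_cont G]) auto
  have [measurable]: "g n \<in> borel_measurable lebesgue" for n
    by (intro borel_measurable_lebesgue_continuous g_cont)
  have g_le: "norm (g n x) \<le> M" for n x
    using mult_mono[OF \<eta>_le[of x] cl_le[of "G n x"]] \<open>M > 0\<close> by (auto simp: g_def norm_mult)
  have g_supp: "g n x = 0" if "norm x > M + 1" for n x
    using that by (simp add: g_def \<eta>_def)
  have "(\<lambda>n. \<integral>x. (norm (h x - g n x))\<^sup>2 \<partial>lebesgue) \<longlonglongrightarrow> (\<integral>x. (0 :: real) \<partial>(lebesgue :: (real^'n) measure))"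
  proof (rule integral_dominated_convergence[where w = "\<lambda>x. (2 * M)\<^sup>2 * indicator (cball 0 (M + 1)) x"])
    show "integrable lebesgue (\<lambda>x :: real^'n. (2 * M)\<^sup>2 * indicator (cball 0 (M + 1)) x)"
      using lmeasurable_cball[of "0 :: real^'n" "M + 1"]
      by (intro integrable_mult_right integrable_real_indicator) (auto simp: fmeasurable_def)
    show "AE x in lebesgue. norm ((norm (h x - g n x))\<^sup>2) \<le> (2 * M)\<^sup>2 * indicator (cball 0 (M + 1)) x" for n
    proof (rule AE_I2)
      fix x
      have "norm (h x - g n x) \<le> 2 * M"
        using norm_triangle_ineq4[of "h x" "g n x"] bd[of x] g_le[of n x] by linarith
      then show "norm ((norm (h x - g n x))\<^sup>2) \<le> (2 * M)\<^sup>2 * indicator (cball 0 (M + 1)) x"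
        using supp[of x] g_supp[of x n] power_mono[of "norm (h x - g n x)" "2 * M" 2] by (auto simp: indicator_def)
    qed
    have "AE x in lebesgue. x \<notin> N"
      using N by (simp add: AE_not_in negligible_iff_null_sets)
    then show "AE x in lebesgue. (\<lambda>n. (norm (h x - g n x))\<^sup>2) \<longlonglongrightarrow> 0"
    proof eventually_elim
      case (elim x)
      have "(\<lambda>n. cl (G n x)) \<longlonglongrightarrow> cl (h x)"
        using continuous_on_tendsto_compose[OF cl_cont lim[OF elim]] by simp
      then have "(\<lambda>n. g n x) \<longlonglongrightarrow> h x"
        unfolding g_def using tendsto_mult[OF tendsto_const, of _ "cl (h x)" _ "\<eta> x"] by (simp add: cl_h \<eta>_h)
      then have "(\<lambda>n. (norm (h x - g n x))\<^sup>2) \<longlonglongrightarrow> (norm (h x - h x))\<^sup>2"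
        by (intro tendsto_intros)
      then show ?case by simp
    qed
  qed auto
  from tendsto_real_sqrt[OF this] have "(\<lambda>n. Lp_norm 2 (\<lambda>x. h x - g n x)) \<longlonglongrightarrow> 0"
    by (simp add: Lp_norm_nonneg flip: Lp_norm_2_power2)
  from order_tendstoD(2)[OF this \<open>e > 0\<close>] obtain n where "Lp_norm 2 (\<lambda>x. h x - g n x) < e"
    using eventually_happens by force
  then show thesis
    using that[of "g n"] g_cont g_le g_supp by blast
qed

lemma continuous_dense_L2:
  fixes f :: "real^'n \<Rightarrow> complex"
  assumes f: "in_Lp 2 f" and e: "e > 0"
  obtains g M where "continuous_on UNIV g" "\<And>x. norm (g x) \<le> M" "\<And>x. norm x > M \<Longrightarrow> g x = 0"
    "Lp_norm 2 (\<lambda>x. f x - g x) < e"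
proof -
  have [measurable]: "f \<in> borel_measurable lebesgue"
    using f by (auto simp: in_Lp_def)
  define h where "h M x = (if norm x \<le> M \<and> norm (f x) \<le> M then f x else 0)" for M x
  have hm[measurable]: "h M \<in> borel_measurable lebesgue" for M
    unfolding h_def[abs_def] by measurable
  have "((\<lambda>M. \<integral>x. (norm (f x - h M x))\<^sup>2 \<partial>lebesgue) \<longlongrightarrow> (\<integral>x. (0 :: real) \<partial>(lebesgue :: (real^'n) measure))) at_top"
  proof (rule integral_dominated_convergence_at_top[where w = "\<lambda>x. (norm (f x))\<^sup>2"])
    show "integrable lebesgue (\<lambda>x. (norm (f x))\<^sup>2)"
      using f by (simp add: in_Lp_2_iff)
    show "\<forall>\<^sub>F M in at_top. AE x in lebesgue. norm ((norm (f x - h M x))\<^sup>2) \<le> (norm (f x))\<^sup>2"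
      by (auto simp: h_def)
    show "AE x in lebesgue. ((\<lambda>M. (norm (f x - h M x))\<^sup>2) \<longlongrightarrow> 0) at_top"
    proof (rule AE_I2)
      fix x
      have "\<forall>\<^sub>F M in at_top. (norm (f x - h M x))\<^sup>2 = 0"
        using eventually_ge_at_top[of "max (norm x) (norm (f x))"] by eventually_elim (simp add: h_def)
      then show "((\<lambda>M. (norm (f x - h M x))\<^sup>2) \<longlongrightarrow> 0) at_top"
        by (rule tendsto_eventually)
    qed
  qed auto
  from tendsto_real_sqrt[OF this] have "((\<lambda>M. Lp_norm 2 (\<lambda>x. f x - h M x)) \<longlongrightarrow> 0) at_top"
    by (simp add: Lp_norm_nonneg flip: Lp_norm_2_power2)
  from order_tendstoD(2)[OF this, of "e / 2"] e
  have "\<forall>\<^sub>F M in at_top. Lp_norm 2 (\<lambda>x. f x - h M x) < e / 2 \<and> M > 0"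
    by (auto intro: eventually_conj eventually_gt_at_top)
  then obtain M where M: "Lp_norm 2 (\<lambda>x. f x - h M x) < e / 2" "M > 0"
    using eventually_happens'[OF trivial_limit_at_top_linorder] by blast
  have h_le: "norm (h M x) \<le> M" and h_supp: "norm x > M \<Longrightarrow> h M x = 0" for x
    using M(2) by (auto simp: h_def)
  obtain g where g: "continuous_on UNIV g" "\<And>x. norm (g x) \<le> M" "\<And>x. norm x > M + 1 \<Longrightarrow> g x = 0"
    and lt: "Lp_norm 2 (\<lambda>x. h M x - g x) < e / 2"
    using continuous_dense_L2_bounded[OF hm M(2) h_le h_supp half_gt_zero[OF e]] by blast
  have h2: "in_Lp 2 (h M)"
    by (rule in_Lp_mono(1)[OF _ f]) (auto simp: h_def)
  have g_le: "norm (g x) \<le> M + 1" for x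
    using g(2)[of x] by simp
  have "in_Lp 2 g"
    by (rule continuous_bounded_support_L1_L2(2)[OF g(1) g_le g(3)])
  then have "Lp_norm 2 (\<lambda>x. f x - g x) < e"
    using Lp_norm_diff_triangle[OF _ f h2 \<open>in_Lp 2 g\<close>] M(1) lt by simp
  then show thesis
    by (intro that[OF g(1) g_le g(3)])
qed

section \<open>The Gaussian and its Fourier transform\<close>

lemma lborel_nn_integral_affine:
  fixes f :: "'a::euclidean_space \<Rightarrow> ennreal"
  assumes [measurable]: "f \<in> borel_measurable borel" and "c \<noteq> 0"
  shows "(\<integral>\<^sup>+x. f x \<partial>lborel) = ennreal (\<bar>c\<bar> ^ DIM('a)) * (\<integral>\<^sup>+x. f (t + c *\<^sub>R x) \<partial>lborel)"
  by (subst lborel_affine[OF \<open>c \<noteq> 0\<close>, of t])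
     (simp add: nn_integral_density nn_integral_distr nn_integral_cmult)

lemma lborel_integral_affine:
  fixes f :: "'a::euclidean_space \<Rightarrow> 'b::{banach, second_countable_topology}"
  assumes [measurable]: "f \<in> borel_measurable borel" and "c \<noteq> 0"
  shows "(\<integral>x. f x \<partial>lborel) = (\<bar>c\<bar> ^ DIM('a)) *\<^sub>R (\<integral>x. f (t + c *\<^sub>R x) \<partial>lborel)"
  by (subst lborel_affine[OF \<open>c \<noteq> 0\<close>, of t])
     (simp add: integral_density integral_distr)

lemma lborel_integral_prod:
  fixes f :: "'a::euclidean_space \<Rightarrow> real \<Rightarrow> 'b::{real_normed_field, banach, second_countable_topology}"
  assumes int: "\<And>b. b \<in> Basis \<Longrightarrow> integrable lborel (f b)"
  shows "(\<integral>x. (\<Prod>b\<in>Basis. f b (x \<bullet> b)) \<partial>lborel) = (\<Prod>b\<in>Basis. \<integral>x. f b x \<partial>lborel)"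
proof -
  interpret product_sigma_finite "\<lambda>_::'a. lborel :: real measure" ..
  have [measurable]: "\<And>b. b \<in> Basis \<Longrightarrow> f b \<in> borel_measurable borel"
    using borel_measurable_integrable[OF int] by simp
  have "(\<integral>x. (\<Prod>b\<in>Basis. f b (x \<bullet> b)) \<partial>lborel)
      = (\<integral>x. (\<Prod>b\<in>Basis. f b ((\<Sum>b\<in>Basis. x b *\<^sub>R b) \<bullet> b)) \<partial>(\<Pi>\<^sub>M b\<in>Basis. lborel))"
    by (subst lborel_eq, subst integral_distr) auto
  also have "\<dots> = (\<integral>x. (\<Prod>b\<in>Basis. f b (x b)) \<partial>(\<Pi>\<^sub>M b\<in>Basis. lborel))"
    by (intro Bochner_Integration.integral_cong prod.cong) auto
  also have "\<dots> = (\<Prod>b\<in>Basis. \<integral>x. f b x \<partial>lborel)"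
    by (rule product_integral_prod) (auto intro: int)
  finally show ?thesis .
qed

text \<open>
  The exchange of integrals in the only form needed: a product of two integrable functions coupled by
  an exponential \<open>k x y\<close> of modulus one. It yields both the Gaussian identity and the duality between the
  Fourier transform and its inverse.
\<close>

lemma bounded_kernel_Fubini:
  fixes A :: "'a::euclidean_space \<Rightarrow> complex" and B :: "'b::euclidean_space \<Rightarrow> complex"
  assumes A: "integrable lborel A" and B: "integrable lborel B"
    and [measurable]: "(\<lambda>(x, y). k x y) \<in> borel_measurable (borel \<Otimes>\<^sub>M borel)"
    and k: "\<And>x y. norm (k x y) \<le> 1"
  shows "(\<integral>x. A x * (\<integral>y. k x y * B y \<partial>lborel) \<partial>lborel) = (\<integral>y. (\<integral>x. k x y * A x \<partial>lborel) * B y \<partial>lborel)"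
proof -
  have [measurable]: "A \<in> borel_measurable borel" "B \<in> borel_measurable borel"
    using A B by auto
  have "integrable (lborel \<Otimes>\<^sub>M lborel) (\<lambda>z. A (fst z) * B (snd z))"
  proof (rule lborel_pair.Fubini_integrable)
    show "integrable lborel (\<lambda>x. LINT y|lborel. cmod (A (fst (x, y)) * B (snd (x, y))))"
      using A by (simp add: norm_mult)
    show "AE x in lborel. integrable lborel (\<lambda>y. A (fst (x, y)) * B (snd (x, y)))"
      using B by simp
  qed measurable
  then have "integrable (lborel \<Otimes>\<^sub>M lborel) (\<lambda>(x, y). A x * (k x y * B y))"
  proof (rule Bochner_Integration.integrable_bound)
    show "AE z in lborel \<Otimes>\<^sub>M lborel. norm (case z of (x, y) \<Rightarrow> A x * (k x y * B y)) \<le> norm (A (fst z) * B (snd z))"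
      using k by (intro AE_I2) (auto simp: norm_mult intro!: mult_left_mono mult_left_le_one_le)
  qed measurable
  from lborel_pair.Fubini_integral[OF this] show ?thesis
    by (simp add: mult_ac flip: integral_mult_right_zero integral_mult_left_zero)
qed

lemma integral_cis_std_normal_density:
  "(\<integral>x. cis (t * x) * of_real (std_normal_density x) \<partial>lborel) = of_real (sqrt (2 * pi) * std_normal_density t)"
proof -
  have "of_real (exp (- (t\<^sup>2) / 2)) = char std_normal_distribution t"
    by (simp add: char_std_normal_distribution)
  also have "\<dots> = (\<integral>x. std_normal_density x *\<^sub>R iexp (t * x) \<partial>lborel)"
    unfolding char_def by (subst integral_density) (auto simp: normal_density_nonneg)
  also have "\<dots> = (\<integral>x. cis (t * x) * of_real (std_normal_density x) \<partial>lborel)"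
    by (simp add: cis_conv_exp scaleR_conv_of_real mult.commute)
  finally show ?thesis
    by (simp add: std_normal_density_def)
qed

text \<open>
  The standard Gaussian density, written as a product so that its integral and its Fourier transform reduce to
  those of the one-dimensional normal distribution.
\<close>

definition gauss :: "'a::euclidean_space \<Rightarrow> real" where
  "gauss x = (\<Prod>b\<in>Basis. std_normal_density (x \<bullet> b))"

lemma gauss_pos: "gauss x > 0"
  unfolding gauss_def by (intro prod_pos) (simp add: normal_density_pos)

lemma gauss_nonneg: "gauss x \<ge> 0"
  using gauss_pos[of x] by simp

lemma continuous_on_gauss: "continuous_on A gauss"
  unfolding gauss_def[abs_def] std_normal_density_def by (intro continuous_intros) auto

lemma measurable_gauss [measurable]: "gauss \<in> borel_measurable borel"
  by (intro borel_measurable_continuous_onI continuous_on_gauss)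

lemma gauss_0: "gauss (0 :: 'a::euclidean_space) = 1 / sqrt (2 * pi) ^ DIM('a)"
  by (simp add: gauss_def std_normal_density_def power_one_over)

lemma gauss_le_0: "gauss (x :: 'a::euclidean_space) \<le> gauss (0 :: 'a)"
  unfolding gauss_def
proof (rule prod_mono, intro conjI)
  fix b :: 'a
  show "std_normal_density (x \<bullet> b) \<le> std_normal_density (0 \<bullet> b)"
    by (simp add: std_normal_density_def divide_right_mono)
qed (simp add: normal_density_nonneg)

lemma nn_integral_gauss: "(\<integral>\<^sup>+x. ennreal (gauss x) \<partial>(lborel :: 'a::euclidean_space measure)) = 1"
proof -
  have "(\<integral>\<^sup>+x. ennreal (gauss x) \<partial>(lborel :: 'a measure))
      = (\<integral>\<^sup>+x. (\<Prod>b\<in>Basis. ennreal (std_normal_density (x \<bullet> b))) \<partial>(lborel :: 'a measure))"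
    unfolding gauss_def by (simp add: prod_ennreal normal_density_nonneg)
  also have "\<dots> = (\<Prod>b\<in>(Basis :: 'a set). \<integral>\<^sup>+x. ennreal (std_normal_density x) \<partial>lborel)"
    by (rule nn_integral_lborel_prod) auto
  also have "(\<integral>\<^sup>+x. ennreal (std_normal_density x) \<partial>lborel) = 1"
    using prob_space.emeasure_space_1[OF prob_space_normal_density[of 1 0]]
    by (simp add: emeasure_density)
  finally show ?thesis by simp
qed

lemma integrable_gauss: "integrable lborel (gauss :: 'a::euclidean_space \<Rightarrow> real)"
  by (rule integrableI_bounded) (auto simp: nn_integral_gauss gauss_nonneg)

lemma integral_gauss: "(\<integral>x. gauss x \<partial>(lborel :: 'a::euclidean_space measure)) = 1"
  using nn_integral_gauss by (subst integral_eq_nn_integral) (auto simp: gauss_nonneg)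

lemma integral_cis_gauss:
  fixes z :: "'a::euclidean_space"
  shows "(\<integral>x. cis (z \<bullet> x) * of_real (gauss x) \<partial>lborel) = of_real (sqrt (2 * pi) ^ DIM('a) * gauss z)"
proof -
  have cis_sum: "cis (sum f A) = (\<Prod>a\<in>A. cis (f a))" if "finite A" for f :: "'a \<Rightarrow> real" and A
    using that by (induction A rule: finite_induct) (auto simp: cis_mult[symmetric])
  have "cis (z \<bullet> x) = (\<Prod>b\<in>Basis. cis ((z \<bullet> b) * (x \<bullet> b)))" for x
    by (subst euclidean_inner, rule cis_sum) simp
  then have "(\<integral>x. cis (z \<bullet> x) * of_real (gauss x) \<partial>lborel)
      = (\<integral>x. (\<Prod>b\<in>Basis. cis ((z \<bullet> b) * (x \<bullet> b)) * of_real (std_normal_density (x \<bullet> b))) \<partial>lborel)"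
    by (simp add: gauss_def prod.distrib)
  also have "\<dots> = (\<Prod>b\<in>Basis. \<integral>x. cis ((z \<bullet> b) * x) * of_real (std_normal_density x) \<partial>lborel)"
  proof (rule lborel_integral_prod)
    fix b :: 'a
    have "continuous_on UNIV (\<lambda>x. cis ((z \<bullet> b) * x))"
      by (intro continuous_intros)
    then have [measurable]: "(\<lambda>x. cis ((z \<bullet> b) * x)) \<in> borel_measurable borel"
      by (rule borel_measurable_continuous_onI)
    have "integrable lborel std_normal_density"
      by simp
    then show "integrable lborel (\<lambda>x. cis ((z \<bullet> b) * x) * of_real (std_normal_density x))"
      by (rule Bochner_Integration.integrable_bound) (auto simp: norm_mult)
  qed
  also have "\<dots> = of_real (sqrt (2 * pi) ^ DIM('a) * gauss z)"
    by (simp add: integral_cis_std_normal_density gauss_def prod.distrib)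
  finally show ?thesis .
qed

lemma measurable_cis [measurable]: "cis \<in> borel_measurable borel"
  by (intro borel_measurable_continuous_onI continuous_intros)

text \<open>
  A Gaussian spread to width \<open>k\<close> on the frequency side becomes one of width \<open>1 / k\<close> on the space side. As
  \<open>k\<close> grows, the former tends to a constant and the latter to a point mass.
\<close>

lemma integral_cis_scaled_gauss:
  fixes z :: "'a::euclidean_space"
  assumes "k > 0"
  shows "(\<integral>x. cis (z \<bullet> x) * of_real (gauss ((1 / k) *\<^sub>R x)) \<partial>lborel)
    = of_real (k ^ DIM('a) * sqrt (2 * pi) ^ DIM('a) * gauss (k *\<^sub>R z))"
proof -
  have "(\<integral>x. cis (z \<bullet> x) * of_real (gauss ((1 / k) *\<^sub>R x)) \<partial>lborel)
      = (\<bar>k\<bar> ^ DIM('a)) *\<^sub>R (\<integral>x. cis (z \<bullet> (0 + k *\<^sub>R x)) * of_real (gauss ((1 / k) *\<^sub>R (0 + k *\<^sub>R x))) \<partial>lborel)"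
    by (rule lborel_integral_affine) (use assms in auto)
  also have "\<dots> = (k ^ DIM('a)) *\<^sub>R (\<integral>x. cis ((k *\<^sub>R z) \<bullet> x) * of_real (gauss x) \<partial>lborel)"
    using assms by simp
  also have "\<dots> = of_real (k ^ DIM('a) * sqrt (2 * pi) ^ DIM('a) * gauss (k *\<^sub>R z))"
    unfolding integral_cis_gauss by (simp add: scaleR_conv_of_real)
  finally show ?thesis .
qed

text \<open>
  With Borel functions, joint measurability of products and kernels on the product space is immediate, so
  Lebesgue measurable functions are replaced by almost everywhere equal Borel ones before integrals are exchanged.
\<close>

lemma borel_representative:
  fixes f :: "'a::euclidean_space \<Rightarrow> complex"
  assumes f: "f \<in> borel_measurable lebesgue"
  obtains g where "g \<in> borel_measurable borel" "AE x in lebesgue. f x = g x"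
proof -
  have "(\<lambda>x. Re (f x)) \<in> borel_measurable lebesgue" "(\<lambda>x. Im (f x)) \<in> borel_measurable lebesgue"
    using f by auto
  then obtain u v where [measurable]: "u \<in> borel_measurable borel" "v \<in> borel_measurable borel"
    and ae: "AE x in lborel. Re (f x) = u x" "AE x in lborel. Im (f x) = v x"
    using completion_ex_borel_measurable_real[of _ lborel] by (metis measurable_lborel2)
  have "AE x in lborel. f x = Complex (u x) (v x)"
    using ae by eventually_elim (simp add: complex_eq_iff)
  moreover have "(\<lambda>x. Complex (u x) (v x)) \<in> borel_measurable borel"
    by (simp add: Complex_eq)
  ultimately show thesis
    using that[of "\<lambda>x. Complex (u x) (v x)"] by (simp add: AE_completion)
qed

section \<open>Plancherel estimates for the Fourier integral\<close>

lemma measurable_cnj [measurable]: "cnj \<in> borel_measurable borel"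
  by (intro borel_measurable_continuous_onI continuous_intros)

lemma integrable_cis_mult:
  assumes "integrable lborel A" and [measurable]: "u \<in> borel_measurable borel"
  shows "integrable lborel (\<lambda>x. cis (u x) * A x)"
  using assms(1) by (rule Bochner_Integration.integrable_bound) (use assms in \<open>auto simp: norm_mult\<close>)

text \<open>
  The Fourier integral without its normalizing factor, over Borel functions and Borel measure.
\<close>

definition fourier_integral :: "('a::euclidean_space \<Rightarrow> complex) \<Rightarrow> 'a \<Rightarrow> complex" where
  "fourier_integral h \<xi> = (\<integral>x. cis (- (x \<bullet> \<xi>)) * h x \<partial>lborel)"

lemma measurable_fourier_integral [measurable]:
  assumes [measurable]: "h \<in> borel_measurable borel"
  shows "fourier_integral h \<in> borel_measurable borel"
  unfolding fourier_integral_def[abs_def] by measurable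

lemma norm_fourier_integral_le: "norm (fourier_integral h \<xi>) \<le> (\<integral>x. norm (h x) \<partial>lborel)"
  unfolding fourier_integral_def
  by (rule order_trans[OF integral_norm_bound]) (simp add: norm_mult)

lemma cnj_fourier_integral: "cnj (fourier_integral h \<xi>) = (\<integral>x. cis (x \<bullet> \<xi>) * cnj (h x) \<partial>lborel)"
  unfolding fourier_integral_def by (subst Bochner_Integration.integral_cnj[symmetric]) (simp add: cis_cnj del: Bochner_Integration.integral_cnj)

text \<open>
  Plancherel's identity with a Gaussian weight. The weight makes the triple integral behind
  \<open>F h \<cdot> cnj (F h)\<close> absolutely convergent, so it may be evaluated by integrating over the frequency first. The result
  is the quadratic form of \<open>h\<close> against an approximate identity.
\<close>

lemma gauss_weighted_Plancherel:
  fixes h :: "'a::euclidean_space \<Rightarrow> complex"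
  assumes h: "integrable lborel h" and k: "k > 0"
  shows "integrable lborel (\<lambda>\<xi>. (norm (fourier_integral h \<xi>))\<^sup>2 * gauss ((1 / k) *\<^sub>R \<xi>))"
    and "complex_of_real (\<integral>\<xi>. (norm (fourier_integral h \<xi>))\<^sup>2 * gauss ((1 / k) *\<^sub>R \<xi>) \<partial>lborel)
      = of_real (sqrt (2 * pi) ^ DIM('a)) *
        (\<integral>x. h x * (\<integral>y. of_real (k ^ DIM('a) * gauss (k *\<^sub>R (y - x))) * cnj (h y) \<partial>lborel) \<partial>lborel)"
proof -
  have [measurable]: "h \<in> borel_measurable borel"
    using h by auto
  define w where "w \<xi> = complex_of_real (gauss ((1 / k) *\<^sub>R \<xi>))" for \<xi> :: 'a
  define H where "H = (\<integral>x. norm (h x) \<partial>lborel)"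
  let ?F = "fourier_integral h"
  have H: "norm (?F \<xi>) \<le> H" for \<xi>
    unfolding H_def by (rule norm_fourier_integral_le)
  have [measurable]: "w \<in> borel_measurable borel"
    unfolding w_def by measurable
  have w: "integrable lborel w"
  proof -
    have "(\<integral>\<^sup>+x. ennreal (gauss ((1 / k) *\<^sub>R x)) \<partial>(lborel :: 'a measure)) = ennreal (\<bar>k\<bar> ^ DIM('a)) * 1"
      using lborel_nn_integral_affine[of "\<lambda>x :: 'a. ennreal (gauss ((1 / k) *\<^sub>R x))" k 0] k
      by (simp add: nn_integral_gauss)
    then show ?thesis
      by (intro integrableI_bounded) (auto simp: w_def gauss_nonneg)
  qed
  have bd: "integrable lborel (\<lambda>\<xi>. v \<xi> * w \<xi>)"
    if [measurable]: "v \<in> borel_measurable borel" and "\<And>\<xi>. norm (v \<xi>) \<le> c" for v c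
  proof (rule Bochner_Integration.integrable_bound)
    show "integrable lborel (\<lambda>\<xi>. of_real c * w \<xi>)"
      using w by simp
    have "norm (v \<xi>) \<le> \<bar>c\<bar>" for \<xi>
      using that(2)[of \<xi>] by linarith
    then show "AE \<xi> in lborel. norm (v \<xi> * w \<xi>) \<le> norm (of_real c * w \<xi>)"
      by (intro AE_I2) (auto simp: norm_mult mult_right_mono)
  qed measurable
  have F2: "of_real ((norm (?F \<xi>))\<^sup>2 * gauss ((1 / k) *\<^sub>R \<xi>)) = ?F \<xi> * (cnj (?F \<xi>) * w \<xi>)" for \<xi>
    unfolding w_def of_real_mult complex_norm_square by (simp add: mult.assoc)
  have "norm (?F \<xi> * cnj (?F \<xi>)) \<le> H * H" for \<xi>
    using H[of \<xi>] by (simp add: norm_mult mult_mono')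
  then have "integrable lborel (\<lambda>\<xi>. complex_of_real ((norm (?F \<xi>))\<^sup>2 * gauss ((1 / k) *\<^sub>R \<xi>)))"
    unfolding F2 using bd[of "\<lambda>\<xi>. ?F \<xi> * cnj (?F \<xi>)" "H * H"] by (simp add: mult.assoc)
  then show "integrable lborel (\<lambda>\<xi>. (norm (?F \<xi>))\<^sup>2 * gauss ((1 / k) *\<^sub>R \<xi>))"
    using integrable_Re by force
  \<comment> \<open>Integrating over the frequency first leaves the transform of the Gaussian at \<open>y - x\<close>.\<close>
  have inner: "(\<integral>\<xi>. cis (- (x \<bullet> \<xi>)) * (cnj (?F \<xi>) * w \<xi>) \<partial>lborel)
      = (\<integral>y. of_real (k ^ DIM('a) * sqrt (2 * pi) ^ DIM('a) * gauss (k *\<^sub>R (y - x))) * cnj (h y) \<partial>lborel)" for x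
  proof -
    have "(\<integral>\<xi>. cis (- (x \<bullet> \<xi>)) * (cnj (?F \<xi>) * w \<xi>) \<partial>lborel)
        = (\<integral>\<xi>. (cis (- (x \<bullet> \<xi>)) * w \<xi>) * (\<integral>y. cis (y \<bullet> \<xi>) * cnj (h y) \<partial>lborel) \<partial>lborel)"
      unfolding cnj_fourier_integral by (simp add: mult_ac)
    also have "\<dots> = (\<integral>y. (\<integral>\<xi>. cis (y \<bullet> \<xi>) * (cis (- (x \<bullet> \<xi>)) * w \<xi>) \<partial>lborel) * cnj (h y) \<partial>lborel)"
      by (rule bounded_kernel_Fubini) (use h in \<open>auto intro!: integrable_cis_mult w\<close>)
    also have "\<dots> = (\<integral>y. (\<integral>\<xi>. cis ((y - x) \<bullet> \<xi>) * w \<xi> \<partial>lborel) * cnj (h y) \<partial>lborel)"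
      by (simp add: inner_diff_left cis_mult flip: mult.assoc)
    also have "\<dots> = (\<integral>y. of_real (k ^ DIM('a) * sqrt (2 * pi) ^ DIM('a) * gauss (k *\<^sub>R (y - x))) * cnj (h y) \<partial>lborel)"
      unfolding w_def integral_cis_scaled_gauss[OF k] ..
    finally show ?thesis .
  qed
  have "complex_of_real (\<integral>\<xi>. (norm (?F \<xi>))\<^sup>2 * gauss ((1 / k) *\<^sub>R \<xi>) \<partial>lborel)
      = (\<integral>\<xi>. ?F \<xi> * (cnj (?F \<xi>) * w \<xi>) \<partial>lborel)"
    by (simp only: F2 flip: integral_complex_of_real)
  also have "\<dots> = (\<integral>\<xi>. (\<integral>x. cis (- (x \<bullet> \<xi>)) * h x \<partial>lborel) * (cnj (?F \<xi>) * w \<xi>) \<partial>lborel)"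
    by (subst fourier_integral_def) simp
  also have "\<dots> = (\<integral>x. h x * (\<integral>\<xi>. cis (- (x \<bullet> \<xi>)) * (cnj (?F \<xi>) * w \<xi>) \<partial>lborel) \<partial>lborel)"
    by (rule bounded_kernel_Fubini[symmetric]) (use h H in \<open>auto intro!: bd[where c = H]\<close>)
  also have "\<dots> = (\<integral>x. h x * (of_real (sqrt (2 * pi) ^ DIM('a)) *
      (\<integral>y. of_real (k ^ DIM('a) * gauss (k *\<^sub>R (y - x))) * cnj (h y) \<partial>lborel)) \<partial>lborel)"
    unfolding inner by (simp add: mult_ac flip: integral_mult_right_zero)
  also have "\<dots> = of_real (sqrt (2 * pi) ^ DIM('a)) *
      (\<integral>x. h x * (\<integral>y. of_real (k ^ DIM('a) * gauss (k *\<^sub>R (y - x))) * cnj (h y) \<partial>lborel) \<partial>lborel)"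
    by (subst integral_mult_right_zero[symmetric]) (simp add: mult_ac)
  finally show "complex_of_real (\<integral>\<xi>. (norm (?F \<xi>))\<^sup>2 * gauss ((1 / k) *\<^sub>R \<xi>) \<partial>lborel)
      = of_real (sqrt (2 * pi) ^ DIM('a)) *
        (\<integral>x. h x * (\<integral>y. of_real (k ^ DIM('a) * gauss (k *\<^sub>R (y - x))) * cnj (h y) \<partial>lborel) \<partial>lborel)" .
qed

lemma ennreal_norm_integral_le: "ennreal (norm (integral\<^sup>L M f)) \<le> (\<integral>\<^sup>+x. ennreal (norm (f x)) \<partial>M)"
  by (cases "integrable M f") (auto intro: integral_norm_bound_ennreal simp: not_integrable_integral_eq)

text \<open>
  Schur's test: \<open>2 |h x| |h y| \<le> |h x|\<^sup>2 + |h y|\<^sup>2\<close>, and the kernel has integral one in each variable.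
\<close>

lemma gauss_quadratic_form_le:
  fixes h :: "'a::euclidean_space \<Rightarrow> complex"
  assumes [measurable]: "h \<in> borel_measurable borel" and k: "k > 0"
  shows "ennreal (norm (\<integral>x. h x * (\<integral>y. of_real (k ^ DIM('a) * gauss (k *\<^sub>R (y - x))) * cnj (h y) \<partial>lborel) \<partial>lborel))
    \<le> (\<integral>\<^sup>+x. ennreal ((norm (h x))\<^sup>2) \<partial>lborel)"
proof -
  define K where "K x y = ennreal (k ^ DIM('a)) * ennreal (gauss (k *\<^sub>R (y - x)))" for x y :: 'a
  have [measurable]: "(\<lambda>(x, y). K x y) \<in> borel_measurable (borel \<Otimes>\<^sub>M borel)"
    unfolding K_def by measurable
  have mass: "(\<integral>\<^sup>+x. ennreal (gauss x) \<partial>(lborel :: 'a measure)) = 1"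
    by (rule nn_integral_gauss)
  have Ky: "(\<integral>\<^sup>+y. K x y \<partial>lborel) = 1" for x
    using lborel_nn_integral_affine[of "\<lambda>y. ennreal (gauss y)" k "- (k *\<^sub>R x)"] k mass
    by (simp add: K_def nn_integral_cmult algebra_simps)
  have Kx: "(\<integral>\<^sup>+x. K x y \<partial>lborel) = 1" for y
    using lborel_nn_integral_affine[of "\<lambda>y. ennreal (gauss y)" "- k" "k *\<^sub>R y"] k mass
    by (simp add: K_def nn_integral_cmult algebra_simps)
  define S where "S = (\<integral>\<^sup>+x. ennreal ((norm (h x))\<^sup>2) \<partial>lborel)"
  let ?I = "\<integral>\<^sup>+x. (\<integral>\<^sup>+y. ennreal (norm (h x)) * (K x y * ennreal (norm (h y))) \<partial>lborel) \<partial>lborel"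
  have AMGM: "2 * (ennreal a * ennreal b) \<le> ennreal (a\<^sup>2) + ennreal (b\<^sup>2)" if "a \<ge> 0" "b \<ge> 0" for a b
  proof -
    have "2 * (a * b) \<le> a\<^sup>2 + b\<^sup>2"
      using sum_squares_bound[of a b] by simp
    then have "ennreal (2 * (a * b)) \<le> ennreal (a\<^sup>2 + b\<^sup>2)"
      by (rule ennreal_leI)
    then show ?thesis
      using that by (simp add: ennreal_mult)
  qed
  have "2 * ?I = (\<integral>\<^sup>+x. (\<integral>\<^sup>+y. 2 * (ennreal (norm (h x)) * ennreal (norm (h y))) * K x y \<partial>lborel) \<partial>lborel)"
    by (simp add: mult_ac flip: nn_integral_cmult)
  also have "\<dots> \<le> (\<integral>\<^sup>+x. (\<integral>\<^sup>+y. (ennreal ((norm (h x))\<^sup>2) + ennreal ((norm (h y))\<^sup>2)) * K x y \<partial>lborel) \<partial>lborel)"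
    by (intro nn_integral_mono mult_right_mono AMGM) auto
  also have "\<dots> = (\<integral>\<^sup>+x. (\<integral>\<^sup>+y. ennreal ((norm (h x))\<^sup>2) * K x y \<partial>lborel) \<partial>lborel)
      + (\<integral>\<^sup>+x. (\<integral>\<^sup>+y. ennreal ((norm (h y))\<^sup>2) * K x y \<partial>lborel) \<partial>lborel)"
    by (simp add: distrib_right nn_integral_add)
  also have "(\<integral>\<^sup>+x. (\<integral>\<^sup>+y. ennreal ((norm (h x))\<^sup>2) * K x y \<partial>lborel) \<partial>lborel) = S"
    by (simp add: nn_integral_cmult Ky S_def)
  also have "(\<integral>\<^sup>+x. (\<integral>\<^sup>+y. ennreal ((norm (h y))\<^sup>2) * K x y \<partial>lborel) \<partial>lborel) = S"
    by (subst lborel_pair.Fubini') (simp_all add: nn_integral_cmult Kx S_def)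
  finally have "2 * ?I \<le> 2 * S"
    by (simp add: mult_2)
  then have I: "?I \<le> S"
    by (subst (asm) ennreal_mult_le_mult_iff) auto
  have "ennreal (norm (\<integral>x. h x * (\<integral>y. of_real (k ^ DIM('a) * gauss (k *\<^sub>R (y - x))) * cnj (h y) \<partial>lborel) \<partial>lborel))
      \<le> (\<integral>\<^sup>+x. ennreal (norm (h x)) * ennreal (norm (\<integral>y. of_real (k ^ DIM('a) * gauss (k *\<^sub>R (y - x))) * cnj (h y) \<partial>lborel)) \<partial>lborel)"
    using ennreal_norm_integral_le[of lborel "\<lambda>x. h x * (\<integral>y. of_real (k ^ DIM('a) * gauss (k *\<^sub>R (y - x))) * cnj (h y) \<partial>lborel)"]
    by (simp add: norm_mult ennreal_mult)
  also have "\<dots> \<le> (\<integral>\<^sup>+x. ennreal (norm (h x)) *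
      (\<integral>\<^sup>+y. ennreal (norm (of_real (k ^ DIM('a) * gauss (k *\<^sub>R (y - x))) * cnj (h y))) \<partial>lborel) \<partial>lborel)"
    by (intro nn_integral_mono mult_left_mono ennreal_norm_integral_le) auto
  also have "\<dots> = ?I"
    using k by (simp add: norm_mult ennreal_mult K_def gauss_nonneg nn_integral_cmult mult.assoc norm_power)
  also note I
  finally show ?thesis
    unfolding S_def .
qed

lemma tendsto_scaled_gauss:
  fixes \<xi> :: "'a::euclidean_space"
  shows "(\<lambda>m. gauss ((1 / real (Suc m)) *\<^sub>R \<xi>)) \<longlonglongrightarrow> gauss (0 :: 'a)"
proof -
  have "(\<lambda>m. (1 / real (Suc m)) *\<^sub>R \<xi>) \<longlonglongrightarrow> 0 *\<^sub>R \<xi>"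
    by (intro tendsto_scaleR tendsto_const LIMSEQ_Suc lim_1_over_n)
  then have "(\<lambda>m. gauss ((1 / real (Suc m)) *\<^sub>R \<xi>)) \<longlonglongrightarrow> gauss (0 *\<^sub>R \<xi>)"
    using continuous_on_tendsto_compose[OF continuous_on_gauss[of UNIV]] by simp
  then show ?thesis by simp
qed

text \<open>
  One half of Plancherel's theorem, for every integrable function: the Gaussian weights increase to a constant, and
  Fatou's lemma removes them.
\<close>

lemma nn_integral_fourier_integral_le:
  fixes h :: "'a::euclidean_space \<Rightarrow> complex"
  assumes h: "integrable lborel h"
  shows "(\<integral>\<^sup>+\<xi>. ennreal ((norm (fourier_integral h \<xi>))\<^sup>2) \<partial>lborel)
    \<le> ennreal ((2 * pi) ^ DIM('a)) * (\<integral>\<^sup>+x. ennreal ((norm (h x))\<^sup>2) \<partial>lborel)"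
proof -
  have [measurable]: "h \<in> borel_measurable borel"
    using h by auto
  let ?F = "fourier_integral h"
  define s where "s = sqrt (2 * pi) ^ DIM('a)"
  have s: "s > 0" "s * s = (2 * pi) ^ DIM('a)" "gauss (0 :: 'a) = 1 / s"
    unfolding s_def power_mult_distrib[symmetric] by (simp_all add: gauss_0)
  define S where "S = (\<integral>\<^sup>+x. ennreal ((norm (h x))\<^sup>2) \<partial>lborel)"
  have le: "(\<integral>\<^sup>+\<xi>. ennreal ((norm (?F \<xi>))\<^sup>2 * gauss ((1 / k) *\<^sub>R \<xi>)) \<partial>lborel) \<le> ennreal s * S" if "k > 0" for k
  proof -
    define Q where "Q = (\<integral>x. h x * (\<integral>y. of_real (k ^ DIM('a) * gauss (k *\<^sub>R (y - x))) * cnj (h y) \<partial>lborel) \<partial>lborel)"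
    have "(\<integral>\<^sup>+\<xi>. ennreal ((norm (?F \<xi>))\<^sup>2 * gauss ((1 / k) *\<^sub>R \<xi>)) \<partial>lborel)
        = ennreal (\<integral>\<xi>. (norm (?F \<xi>))\<^sup>2 * gauss ((1 / k) *\<^sub>R \<xi>) \<partial>lborel)"
      by (rule nn_integral_eq_integral[OF gauss_weighted_Plancherel(1)[OF h that]]) (simp add: gauss_nonneg)
    also have "\<dots> \<le> ennreal (norm (complex_of_real (\<integral>\<xi>. (norm (?F \<xi>))\<^sup>2 * gauss ((1 / k) *\<^sub>R \<xi>) \<partial>lborel)))"
      by (intro ennreal_leI) simp
    also have "\<dots> = ennreal s * ennreal (norm Q)"
      unfolding gauss_weighted_Plancherel(2)[OF h that] Q_def[symmetric] s_def[symmetric]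
      using s(1) by (simp add: norm_mult ennreal_mult)
    also have "\<dots> \<le> ennreal s * S"
      unfolding Q_def S_def by (intro mult_left_mono gauss_quadratic_form_le that) auto
    finally show ?thesis .
  qed
  have "ennreal (1 / s) * (\<integral>\<^sup>+\<xi>. ennreal ((norm (?F \<xi>))\<^sup>2) \<partial>lborel)
      = (\<integral>\<^sup>+\<xi>. ennreal ((norm (?F \<xi>))\<^sup>2 * gauss (0 :: 'a)) \<partial>lborel)"
    using s(1) unfolding s(3)
    by (subst nn_integral_cmult[symmetric]) (auto simp: mult.commute simp flip: ennreal_mult)
  also have "\<dots> \<le> (\<integral>\<^sup>+\<xi>. liminf (\<lambda>m. ennreal ((norm (?F \<xi>))\<^sup>2 * gauss ((1 / real (Suc m)) *\<^sub>R \<xi>))) \<partial>lborel)"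
  proof (rule nn_integral_mono)
    fix \<xi> :: 'a
    have "(\<lambda>m. ennreal ((norm (?F \<xi>))\<^sup>2 * gauss ((1 / real (Suc m)) *\<^sub>R \<xi>))) \<longlonglongrightarrow> ennreal ((norm (?F \<xi>))\<^sup>2 * gauss (0 :: 'a))"
      by (intro tendsto_ennrealI tendsto_mult tendsto_const tendsto_scaled_gauss)
    from lim_imp_Liminf[OF _ this]
    show "ennreal ((norm (?F \<xi>))\<^sup>2 * gauss (0 :: 'a)) \<le> liminf (\<lambda>m. ennreal ((norm (?F \<xi>))\<^sup>2 * gauss ((1 / real (Suc m)) *\<^sub>R \<xi>)))"
      by simp
  qed
  also have "\<dots> \<le> liminf (\<lambda>m. \<integral>\<^sup>+\<xi>. ennreal ((norm (?F \<xi>))\<^sup>2 * gauss ((1 / real (Suc m)) *\<^sub>R \<xi>)) \<partial>lborel)"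
    by (rule nn_integral_liminf) measurable
  also have "\<dots> \<le> ennreal s * S"
    by (rule order_trans[OF Liminf_le_Limsup Limsup_bounded]) (auto intro!: le always_eventually)
  finally have "ennreal s * (ennreal (1 / s) * (\<integral>\<^sup>+\<xi>. ennreal ((norm (?F \<xi>))\<^sup>2) \<partial>lborel)) \<le> ennreal s * (ennreal s * S)"
    by (rule mult_left_mono) simp
  then show ?thesis
    using s(1,2) by (simp add: S_def flip: mult.assoc ennreal_mult')
qed

text \<open>
  The other half of Plancherel's theorem, for functions for which the convergence of the approximate identity is
  elementary: when \<open>g\<close> is continuous, its averages \<open>J m\<close> tend to \<open>cnj g\<close> pointwise, and boundedness and bounded
  support allow dominated convergence.
\<close>

lemma fourier_integral_norm_ge:
  fixes g :: "'a::euclidean_space \<Rightarrow> complex"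
  assumes cont: "continuous_on UNIV g" and bd: "\<And>x. norm (g x) \<le> M" and supp: "\<And>x. norm x > M \<Longrightarrow> g x = 0"
  shows "ennreal ((2 * pi) ^ DIM('a)) * (\<integral>\<^sup>+x. ennreal ((norm (g x))\<^sup>2) \<partial>lborel)
    \<le> (\<integral>\<^sup>+\<xi>. ennreal ((norm (fourier_integral g \<xi>))\<^sup>2) \<partial>lborel)"
proof -
  have [measurable]: "g \<in> borel_measurable borel"
    using cont by (rule borel_measurable_continuous_onI)
  have M: "M \<ge> 0"
    using bd[of 0] norm_ge_zero order_trans by blast
  have g: "integrable lborel g" and g2: "integrable lborel (\<lambda>x. (norm (g x))\<^sup>2)"
    by (rule continuous_bounded_support_integrable[OF assms]; assumption)+
  let ?F = "fourier_integral g"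
  define s where "s = sqrt (2 * pi) ^ DIM('a)"
  have s: "s > 0" "s * s = (2 * pi) ^ DIM('a)" "gauss (0 :: 'a) = 1 / s"
    unfolding s_def power_mult_distrib[symmetric] by (simp_all add: gauss_0)
  define S where "S = (\<integral>x. (norm (g x))\<^sup>2 \<partial>lborel)"
  define k where "k m = real (Suc m)" for m
  have k: "k m > 0" for m
    by (simp add: k_def)
  define J where "J m x = (\<integral>y. of_real (k m ^ DIM('a) * gauss (k m *\<^sub>R (y - x))) * cnj (g y) \<partial>lborel)" for m x
  have J: "J m x = (\<integral>z. of_real (gauss z) * cnj (g (x + (1 / k m) *\<^sub>R z)) \<partial>lborel)" for m x
  proof -
    have "J m x = (\<bar>1 / k m\<bar> ^ DIM('a)) *\<^sub>R
        (\<integral>z. of_real (k m ^ DIM('a) * gauss (k m *\<^sub>R (x + (1 / k m) *\<^sub>R z - x))) * cnj (g (x + (1 / k m) *\<^sub>R z)) \<partial>lborel)"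
      unfolding J_def by (rule lborel_integral_affine) (use k[of m] in auto)
    also have "\<dots> = (\<integral>z. ((1 / k m) ^ DIM('a)) *\<^sub>R
        (of_real (k m ^ DIM('a) * gauss z) * cnj (g (x + (1 / k m) *\<^sub>R z))) \<partial>lborel)"
      using k[of m] by simp
    also have "\<dots> = (\<integral>z. of_real (gauss z) * cnj (g (x + (1 / k m) *\<^sub>R z)) \<partial>lborel)"
      using k[of m] by (simp add: scaleR_conv_of_real power_one_over field_simps)
    finally show ?thesis .
  qed
  have [measurable]: "J m \<in> borel_measurable borel" for m
    unfolding J_def by measurable
  have J_le: "norm (J m x) \<le> M" for m x
  proof -
    have "norm (J m x) \<le> (\<integral>z. norm (of_real (gauss z) * cnj (g (x + (1 / k m) *\<^sub>R z))) \<partial>lborel)"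
      unfolding J by (rule integral_norm_bound)
    also have "\<dots> \<le> (\<integral>z. M * gauss z \<partial>(lborel :: 'a measure))"
    proof (rule integral_mono')
      show "integrable lborel (\<lambda>z :: 'a. M * gauss z)"
        by (intro integrable_mult_right integrable_gauss)
      show "norm (of_real (gauss z) * cnj (g (x + (1 / k m) *\<^sub>R z))) \<le> M * gauss z" for z
        using mult_right_mono[OF bd gauss_nonneg] by (simp add: norm_mult gauss_nonneg mult.commute)
      show "0 \<le> M * gauss z" for z :: 'a
        using M by (simp add: gauss_nonneg)
    qed
    finally show ?thesis
      by (simp add: integral_gauss)
  qed
  have J_lim: "(\<lambda>m. J m x) \<longlonglongrightarrow> cnj (g x)" for x
  proof -
    have "(\<lambda>m. J m x) \<longlonglongrightarrow> (\<integral>z. of_real (gauss z) * cnj (g x) \<partial>(lborel :: 'a measure))"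
      unfolding J
    proof (rule integral_dominated_convergence)
      show "integrable lborel (\<lambda>z :: 'a. M * gauss z)"
        by (intro integrable_mult_right integrable_gauss)
      show "AE z in lborel. norm (of_real (gauss z) * cnj (g (x + (1 / k m) *\<^sub>R z))) \<le> M * gauss z" for m
        using mult_right_mono[OF bd gauss_nonneg] by (intro AE_I2) (simp add: norm_mult gauss_nonneg mult.commute)
      show "AE z in lborel. (\<lambda>m. of_real (gauss z) * cnj (g (x + (1 / k m) *\<^sub>R z))) \<longlonglongrightarrow> of_real (gauss z) * cnj (g x)"
      proof (rule AE_I2)
        fix z :: 'a
        have "(\<lambda>m. x + (1 / k m) *\<^sub>R z) \<longlonglongrightarrow> x + 0 *\<^sub>R z"
          unfolding k_def by (intro tendsto_add tendsto_scaleR tendsto_const LIMSEQ_Suc lim_1_over_n)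
        then have "(\<lambda>m. g (x + (1 / k m) *\<^sub>R z)) \<longlonglongrightarrow> g x"
          using continuous_on_tendsto_compose[OF cont] by simp
        then show "(\<lambda>m. of_real (gauss z) * cnj (g (x + (1 / k m) *\<^sub>R z))) \<longlonglongrightarrow> of_real (gauss z) * cnj (g x)"
          by (intro tendsto_mult tendsto_const tendsto_cnj)
      qed
    qed measurable
    also have "(\<integral>z. of_real (gauss z) * cnj (g x) \<partial>(lborel :: 'a measure)) = cnj (g x)"
      by (simp add: integral_gauss)
    finally show ?thesis .
  qed
  \<comment> \<open>The limit is the squared norm of \<open>g\<close>; on the frequency side, the weights are at most \<open>gauss 0\<close>.\<close>
  have "(\<lambda>m. \<integral>x. g x * J m x \<partial>lborel) \<longlonglongrightarrow> (\<integral>x. g x * cnj (g x) \<partial>lborel)"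
  proof (rule integral_dominated_convergence)
    show "integrable lborel (\<lambda>x. norm (g x) * M)"
      using g by simp
    show "AE x in lborel. norm (g x * J m x) \<le> norm (g x) * M" for m
      using J_le by (intro AE_I2) (simp add: norm_mult mult_left_mono)
    show "AE x in lborel. (\<lambda>m. g x * J m x) \<longlonglongrightarrow> g x * cnj (g x)"
      by (intro AE_I2 tendsto_mult tendsto_const J_lim)
  qed measurable
  also have "(\<integral>x. g x * cnj (g x) \<partial>lborel) = of_real S"
    unfolding S_def by (simp only: complex_norm_square flip: integral_complex_of_real)
  finally have "(\<lambda>m. of_real s * (\<integral>x. g x * J m x \<partial>lborel)) \<longlonglongrightarrow> of_real s * complex_of_real S"
    by (intro tendsto_mult tendsto_const)
  then have "(\<lambda>m. Re (of_real s * (\<integral>x. g x * J m x \<partial>lborel))) \<longlonglongrightarrow> Re (of_real s * complex_of_real S)"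
    by (rule tendsto_Re)
  moreover have "Re (of_real s * (\<integral>x. g x * J m x \<partial>lborel)) = (\<integral>\<xi>. (norm (?F \<xi>))\<^sup>2 * gauss ((1 / k m) *\<^sub>R \<xi>) \<partial>lborel)" for m
    unfolding s_def J_def gauss_weighted_Plancherel(2)[OF g k, symmetric] by simp
  ultimately have "(\<lambda>m. \<integral>\<xi>. (norm (?F \<xi>))\<^sup>2 * gauss ((1 / k m) *\<^sub>R \<xi>) \<partial>lborel) \<longlonglongrightarrow> s * S"
    by simp
  then have lim: "(\<lambda>m. ennreal (\<integral>\<xi>. (norm (?F \<xi>))\<^sup>2 * gauss ((1 / k m) *\<^sub>R \<xi>) \<partial>lborel)) \<longlonglongrightarrow> ennreal (s * S)"
    by (rule tendsto_ennrealI)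
  have "ennreal (s * S) \<le> (\<integral>\<^sup>+\<xi>. ennreal ((norm (?F \<xi>))\<^sup>2 * (1 / s)) \<partial>lborel)"
  proof (rule tendsto_upperbound[OF lim])
    have "ennreal (\<integral>\<xi>. (norm (?F \<xi>))\<^sup>2 * gauss ((1 / k m) *\<^sub>R \<xi>) \<partial>lborel)
        \<le> (\<integral>\<^sup>+\<xi>. ennreal ((norm (?F \<xi>))\<^sup>2 * (1 / s)) \<partial>lborel)" for m
    proof -
      have "ennreal (\<integral>\<xi>. (norm (?F \<xi>))\<^sup>2 * gauss ((1 / k m) *\<^sub>R \<xi>) \<partial>lborel)
          = (\<integral>\<^sup>+\<xi>. ennreal ((norm (?F \<xi>))\<^sup>2 * gauss ((1 / k m) *\<^sub>R \<xi>)) \<partial>lborel)"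
        by (rule nn_integral_eq_integral[OF gauss_weighted_Plancherel(1)[OF g k], symmetric]) (simp add: gauss_nonneg)
      also have "\<dots> \<le> (\<integral>\<^sup>+\<xi>. ennreal ((norm (?F \<xi>))\<^sup>2 * (1 / s)) \<partial>lborel)"
        using gauss_le_0[where 'a = 'a] unfolding s(3)
        by (intro nn_integral_mono ennreal_leI mult_left_mono) auto
      finally show ?thesis .
    qed
    then show "\<forall>\<^sub>F m in sequentially. ennreal (\<integral>\<xi>. (norm (?F \<xi>))\<^sup>2 * gauss ((1 / k m) *\<^sub>R \<xi>) \<partial>lborel)
        \<le> (\<integral>\<^sup>+\<xi>. ennreal ((norm (?F \<xi>))\<^sup>2 * (1 / s)) \<partial>lborel)"
      by (rule always_eventually[OF allI])
  qed simp
  also have "\<dots> = ennreal (1 / s) * (\<integral>\<^sup>+\<xi>. ennreal ((norm (?F \<xi>))\<^sup>2) \<partial>lborel)"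
    using s(1) by (subst nn_integral_cmult[symmetric]) (auto simp: mult.commute simp flip: ennreal_mult)
  finally have "ennreal s * ennreal (s * S) \<le> ennreal s * (ennreal (1 / s) * (\<integral>\<^sup>+\<xi>. ennreal ((norm (?F \<xi>))\<^sup>2) \<partial>lborel))"
    by (rule mult_left_mono) simp
  moreover have "(\<integral>\<^sup>+x. ennreal ((norm (g x))\<^sup>2) \<partial>lborel) = ennreal S"
    unfolding S_def by (rule nn_integral_eq_integral[OF g2]) simp
  moreover have "ennreal s * ennreal (s * S) = ennreal ((2 * pi) ^ DIM('a)) * ennreal S"
    using s(1) unfolding s(2)[symmetric]
    by (simp only: ennreal_mult'[symmetric] less_imp_le mult_nonneg_nonneg mult.assoc)
  moreover have "ennreal s * (ennreal (1 / s) * I) = I" for I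
    using s(1) by (simp flip: mult.assoc ennreal_mult')
  ultimately show ?thesis
    by simp
qed

section \<open>The Fourier transform on square-integrable functions\<close>

abbreviation fourier_const :: "'n::finite itself \<Rightarrow> real" where
  "fourier_const _ \<equiv> (2 * pi) powr (- real CARD('n) / 2)"

text \<open>
  The normalizing factor is chosen to cancel the constant in the Plancherel estimates for \<open>fourier_integral\<close>.
\<close>

lemma fourier_const_power2: "(fourier_const TYPE('n::finite))\<^sup>2 * (2 * pi) ^ DIM(real^'n) = 1"
proof -
  have "(fourier_const TYPE('n))\<^sup>2 = (2 * pi) powr (- real CARD('n))"
    by (simp add: power2_eq_square flip: powr_add)
  also have "\<dots> = inverse ((2 * pi) ^ CARD('n))"
    unfolding powr_minus by (subst powr_realpow) simp_all
  finally have *: "(fourier_const TYPE('n))\<^sup>2 = inverse ((2 * pi) ^ CARD('n))" .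
  have "(2 * pi) ^ CARD('n) \<noteq> 0"
    by simp
  then show ?thesis
    unfolding * DIM_cart DIM_real mult_1_right by (rule left_inverse)
qed

lemma measurable_lebesgue_cis_inner [measurable]:
  "(\<lambda>x. cis (x \<bullet> y)) \<in> borel_measurable lebesgue" "(\<lambda>x. cis (- (x \<bullet> y))) \<in> borel_measurable lebesgue"
  for y :: "'a::euclidean_space"
  by (intro borel_measurable_lebesgue_continuous continuous_intros)+

lemma integrable_lebesgue_cis_mult:
  assumes h: "integrable lebesgue h"
  shows "integrable lebesgue (\<lambda>x. cis (x \<bullet> y) * h x)" "integrable lebesgue (\<lambda>x. cis (- (x \<bullet> y)) * h x)"
proof -
  have [measurable]: "h \<in> borel_measurable lebesgue"
    using h by (rule borel_measurable_integrable)
  show "integrable lebesgue (\<lambda>x. cis (x \<bullet> y) * h x)" "integrable lebesgue (\<lambda>x. cis (- (x \<bullet> y)) * h x)"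
    by (rule Bochner_Integration.integrable_bound[OF h]; simp add: norm_mult)+
qed

lemma integrable_borel_representative:
  fixes h :: "real^'n \<Rightarrow> complex"
  assumes h: "integrable lebesgue h"
  obtains g where "integrable lborel g" "g \<in> borel_measurable borel" "AE x in lebesgue. h x = g x"
    "fourier_L1 h = (\<lambda>\<xi>. of_real (fourier_const TYPE('n)) * fourier_integral g \<xi>)"
proof -
  have hm[measurable]: "h \<in> borel_measurable lebesgue"
    using h by (rule borel_measurable_integrable)
  obtain g where [measurable]: "g \<in> borel_measurable borel" and ae: "AE x in lebesgue. h x = g x"
    by (rule borel_representative[OF hm])
  have gm[measurable]: "g \<in> borel_measurable lebesgue"
    by (rule measurable_completion) simp
  have "integrable lebesgue g"
    using h integrable_cong_AE[OF hm gm ae] by simp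
  then have "integrable lborel g"
    by (simp add: integrable_completion)
  moreover have "fourier_L1 h = (\<lambda>\<xi>. of_real (fourier_const TYPE('n)) * fourier_integral g \<xi>)"
  proof
    fix \<xi>
    have "(\<integral>x. cis (- (x \<bullet> \<xi>)) * h x \<partial>lebesgue) = (\<integral>x. cis (- (x \<bullet> \<xi>)) * g x \<partial>lebesgue)"
      by (rule integral_cong_AE) (use ae in \<open>auto elim: eventually_mono\<close>)
    also have "\<dots> = fourier_integral g \<xi>"
      unfolding fourier_integral_def by (rule integral_completion) measurable
    finally show "fourier_L1 h \<xi> = of_real (fourier_const TYPE('n)) * fourier_integral g \<xi>"
      by (simp add: fourier_L1_def)
  qed
  ultimately show thesis
    using that ae by simp
qed

lemma measurable_fourier_L1:
  fixes h :: "real^'n \<Rightarrow> complex"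
  assumes "integrable lebesgue h"
  shows "fourier_L1 h \<in> borel_measurable lebesgue"
proof -
  obtain g where [measurable]: "g \<in> borel_measurable borel"
    and eq: "fourier_L1 h = (\<lambda>\<xi>. of_real (fourier_const TYPE('n)) * fourier_integral g \<xi>)"
    by (rule integrable_borel_representative[OF assms])
  show ?thesis
    unfolding eq by (rule measurable_completion) measurable
qed

lemma nn_integral_fourier_const:
  fixes g :: "real^'n \<Rightarrow> complex"
  assumes [measurable]: "g \<in> borel_measurable borel"
  shows "(\<integral>\<^sup>+\<xi>. ennreal ((norm (of_real (fourier_const TYPE('n)) * fourier_integral g \<xi>))\<^sup>2) \<partial>lborel)
    = ennreal ((fourier_const TYPE('n))\<^sup>2) * (\<integral>\<^sup>+\<xi>. ennreal ((norm (fourier_integral g \<xi>))\<^sup>2) \<partial>lborel)"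
  by (subst nn_integral_cmult[symmetric]) (auto simp: norm_mult power_mult_distrib simp flip: ennreal_mult)

lemma nn_integral_lebesgue_norm2_cong:
  fixes h g :: "'a::euclidean_space \<Rightarrow> complex"
  assumes "AE x in lebesgue. h x = g x"
  shows "(\<integral>\<^sup>+x. ennreal ((norm (h x))\<^sup>2) \<partial>lebesgue) = (\<integral>\<^sup>+x. ennreal ((norm (g x))\<^sup>2) \<partial>lborel)"
  unfolding nn_integral_completion[symmetric, of lborel]
  by (rule nn_integral_cong_AE) (use assms in \<open>auto elim: eventually_mono\<close>)

lemma fourier_L1_L2_bound:
  fixes h :: "real^'n \<Rightarrow> complex"
  assumes h: "integrable lebesgue h" and h2: "in_Lp 2 h"
  shows "in_Lp 2 (fourier_L1 h)" and "Lp_norm 2 (fourier_L1 h) \<le> Lp_norm 2 h"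
proof -
  obtain g where g: "integrable lborel g" and [measurable]: "g \<in> borel_measurable borel"
    and ae: "AE x in lebesgue. h x = g x"
    and eq: "fourier_L1 h = (\<lambda>\<xi>. of_real (fourier_const TYPE('n)) * fourier_integral g \<xi>)"
    by (rule integrable_borel_representative[OF h])
  have "(\<integral>\<^sup>+\<xi>. ennreal ((norm (fourier_L1 h \<xi>))\<^sup>2) \<partial>lebesgue)
      = ennreal ((fourier_const TYPE('n))\<^sup>2) * (\<integral>\<^sup>+\<xi>. ennreal ((norm (fourier_integral g \<xi>))\<^sup>2) \<partial>lborel)"
    unfolding eq nn_integral_completion by (rule nn_integral_fourier_const) simp
  also have "\<dots> \<le> ennreal ((fourier_const TYPE('n))\<^sup>2) *
      (ennreal ((2 * pi) ^ DIM(real^'n)) * (\<integral>\<^sup>+x. ennreal ((norm (g x))\<^sup>2) \<partial>lborel))"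
    by (intro mult_left_mono nn_integral_fourier_integral_le g) simp
  also have "\<dots> = ennreal ((fourier_const TYPE('n))\<^sup>2 * (2 * pi) ^ DIM(real^'n)) * (\<integral>\<^sup>+x. ennreal ((norm (h x))\<^sup>2) \<partial>lebesgue)"
    unfolding nn_integral_lebesgue_norm2_cong[OF ae] by (subst ennreal_mult') (simp_all add: mult.assoc)
  also have "\<dots> = ennreal ((Lp_norm 2 h)\<^sup>2)"
    unfolding fourier_const_power2 using h2 by (simp add: nn_integral_power2_eq_Lp_norm)
  finally have le: "(\<integral>\<^sup>+\<xi>. ennreal ((norm (fourier_L1 h \<xi>))\<^sup>2) \<partial>lebesgue) \<le> ennreal ((Lp_norm 2 h)\<^sup>2)" .
  show "in_Lp 2 (fourier_L1 h)" "Lp_norm 2 (fourier_L1 h) \<le> Lp_norm 2 h"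
    using L2_norm_leI[OF Lp_norm_nonneg measurable_fourier_L1[OF h] le] by auto
qed

lemma fourier_L1_diff:
  assumes "integrable lebesgue f" "integrable lebesgue g"
  shows "fourier_L1 (\<lambda>x. f x - g x) \<xi> = fourier_L1 f \<xi> - fourier_L1 g \<xi>"
  using Bochner_Integration.integral_diff[OF integrable_lebesgue_cis_mult(2)[OF assms(1)]
      integrable_lebesgue_cis_mult(2)[OF assms(2)], of \<xi> \<xi>]
  by (simp add: fourier_L1_def right_diff_distrib)

lemma Plancherel_continuous:
  fixes g :: "real^'n \<Rightarrow> complex"
  assumes cont: "continuous_on UNIV g" and bd: "\<And>x. norm (g x) \<le> M" and supp: "\<And>x. norm x > M \<Longrightarrow> g x = 0"
  shows "Lp_norm 2 g \<le> Lp_norm 2 (fourier_L1 g)"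
proof -
  have gi: "integrable lebesgue g" and g2: "in_Lp 2 g"
    by (rule continuous_bounded_support_L1_L2[OF assms]; assumption)+
  have [measurable]: "g \<in> borel_measurable borel"
    using cont by (rule borel_measurable_continuous_onI)
  have eq: "fourier_L1 g = (\<lambda>\<xi>. of_real (fourier_const TYPE('n)) * fourier_integral g \<xi>)"
    unfolding fourier_L1_def[abs_def] fourier_integral_def[abs_def]
    by (subst integral_completion) auto
  have "(\<integral>\<^sup>+x. ennreal ((norm (g x))\<^sup>2) \<partial>lebesgue)
      = ennreal ((fourier_const TYPE('n))\<^sup>2 * (2 * pi) ^ DIM(real^'n)) * (\<integral>\<^sup>+x. ennreal ((norm (g x))\<^sup>2) \<partial>lborel)"
    unfolding fourier_const_power2 by (simp add: nn_integral_completion)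
  also have "\<dots> = ennreal ((fourier_const TYPE('n))\<^sup>2) *
      (ennreal ((2 * pi) ^ DIM(real^'n)) * (\<integral>\<^sup>+x. ennreal ((norm (g x))\<^sup>2) \<partial>lborel))"
    by (subst ennreal_mult') (simp_all add: mult.assoc)
  also have "\<dots> \<le> ennreal ((fourier_const TYPE('n))\<^sup>2) * (\<integral>\<^sup>+\<xi>. ennreal ((norm (fourier_integral g \<xi>))\<^sup>2) \<partial>lborel)"
    by (intro mult_left_mono fourier_integral_norm_ge[OF assms]) simp_all
  also have "\<dots> = (\<integral>\<^sup>+\<xi>. ennreal ((norm (fourier_L1 g \<xi>))\<^sup>2) \<partial>lebesgue)"
    unfolding eq nn_integral_completion by (rule nn_integral_fourier_const[symmetric]) simp
  finally have "ennreal ((Lp_norm 2 g)\<^sup>2) \<le> ennreal ((Lp_norm 2 (fourier_L1 g))\<^sup>2)"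
    using g2 fourier_L1_L2_bound(1)[OF gi g2] by (simp add: nn_integral_power2_eq_Lp_norm)
  then show ?thesis
    by (intro power2_le_imp_le[OF _ Lp_norm_nonneg]) simp
qed

text \<open>
  The lower bound extends from continuous functions by density. The upper bound, already known on all of
  \<open>L\<^sup>1 \<inter> L\<^sup>2\<close>, controls the error made on the Fourier side.
\<close>

theorem Plancherel_L1_L2:
  fixes h :: "real^'n \<Rightarrow> complex"
  assumes h: "integrable lebesgue h" and h2: "in_Lp 2 h"
  shows "Lp_norm 2 (fourier_L1 h) = Lp_norm 2 h"
proof (rule antisym)
  show "Lp_norm 2 (fourier_L1 h) \<le> Lp_norm 2 h"
    using h h2 by (rule fourier_L1_L2_bound)
  show "Lp_norm 2 h \<le> Lp_norm 2 (fourier_L1 h)"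
  proof (rule field_le_epsilon)
    fix e :: real assume "e > 0"
    then have e2: "e / 2 > 0" by simp
    obtain g M where cont: "continuous_on UNIV g" and bd: "\<And>x. norm (g x) \<le> M"
      and supp: "\<And>x. norm x > M \<Longrightarrow> g x = 0" and lt: "Lp_norm 2 (\<lambda>x. h x - g x) < e / 2"
      using continuous_dense_L2[OF h2 e2] by blast
    have gi: "integrable lebesgue g" and g2: "in_Lp 2 g"
      by (rule continuous_bounded_support_L1_L2[OF cont bd supp]; assumption)+
    have "Lp_norm 2 h \<le> Lp_norm 2 g + Lp_norm 2 (\<lambda>x. h x - g x)"
      by (rule Lp_norm_triangle_sub) (use h2 g2 in auto)
    also have "Lp_norm 2 g \<le> Lp_norm 2 (fourier_L1 g)"
      by (rule Plancherel_continuous[OF cont bd supp])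
    also have "\<dots> \<le> Lp_norm 2 (fourier_L1 h) + Lp_norm 2 (\<lambda>\<xi>. fourier_L1 g \<xi> - fourier_L1 h \<xi>)"
      by (rule Lp_norm_triangle_sub) (use fourier_L1_L2_bound(1) h h2 gi g2 in auto)
    also have "Lp_norm 2 (\<lambda>\<xi>. fourier_L1 g \<xi> - fourier_L1 h \<xi>) \<le> Lp_norm 2 (\<lambda>x. g x - h x)"
      unfolding fourier_L1_diff[OF gi h, symmetric]
      by (rule fourier_L1_L2_bound(2)) (use h h2 gi g2 in \<open>auto intro: Lp_norm_diff(1)\<close>)
    finally show "Lp_norm 2 h \<le> Lp_norm 2 (fourier_L1 h) + e"
      using lt by (simp add: Lp_norm_minus_commute[of 2 g h])
  qed
qed

lemma is_fourier_L2_iff: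
  fixes f g :: "real^'n \<Rightarrow> complex"
  assumes f: "in_Lp 2 f"
  shows "is_fourier_L2 f g \<longleftrightarrow> in_Lp 2 g \<and>
    ((\<lambda>R. Lp_norm 2 (\<lambda>\<xi>. fourier_L1 (truncate R f) \<xi> - g \<xi>)) \<longlongrightarrow> 0) at_top"
proof (cases "in_Lp 2 g")
  case True
  have diff: "in_Lp 2 (\<lambda>\<xi>. fourier_L1 (truncate R f) \<xi> - g \<xi>)" for R
    by (rule Lp_norm_diff(1)[OF _ fourier_L1_L2_bound(1)[OF integrable_truncate_L2[OF f] in_Lp_truncate[OF _ f]] True]) simp_all
  have trunc: "(\<lambda>x. if norm x \<le> R then f x else 0) = truncate R f" for R
    by (simp add: truncate_def fun_eq_iff)
  have "is_fourier_L2 f g \<longleftrightarrow>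
      ((\<lambda>R. ennreal ((Lp_norm 2 (\<lambda>\<xi>. fourier_L1 (truncate R f) \<xi> - g \<xi>))\<^sup>2)) \<longlongrightarrow> 0) at_top"
    unfolding is_fourier_L2_def trunc nn_integral_power2_eq_Lp_norm[OF diff] using True by simp
  also have "\<dots> \<longleftrightarrow> ((\<lambda>R. (Lp_norm 2 (\<lambda>\<xi>. fourier_L1 (truncate R f) \<xi> - g \<xi>))\<^sup>2) \<longlongrightarrow> 0) at_top"
    by (rule tendsto_ennreal_iff[where x = 0, simplified]) simp
  also have "\<dots> \<longleftrightarrow> ((\<lambda>R. Lp_norm 2 (\<lambda>\<xi>. fourier_L1 (truncate R f) \<xi> - g \<xi>)) \<longlongrightarrow> 0) at_top"
  proof
    assume "((\<lambda>R. (Lp_norm 2 (\<lambda>\<xi>. fourier_L1 (truncate R f) \<xi> - g \<xi>))\<^sup>2) \<longlongrightarrow> 0) at_top"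
    from tendsto_real_sqrt[OF this]
    show "((\<lambda>R. Lp_norm 2 (\<lambda>\<xi>. fourier_L1 (truncate R f) \<xi> - g \<xi>)) \<longlongrightarrow> 0) at_top"
      by (simp add: Lp_norm_nonneg)
  next
    assume "((\<lambda>R. Lp_norm 2 (\<lambda>\<xi>. fourier_L1 (truncate R f) \<xi> - g \<xi>)) \<longlongrightarrow> 0) at_top"
    from tendsto_power[OF this, of 2]
    show "((\<lambda>R. (Lp_norm 2 (\<lambda>\<xi>. fourier_L1 (truncate R f) \<xi> - g \<xi>))\<^sup>2) \<longlongrightarrow> 0) at_top"
      by simp
  qed
  finally show ?thesis
    using True by simp
qed (simp add: is_fourier_L2_def)

text \<open>
  The truncations of \<open>f\<close> converge in \<open>L\<^sup>2\<close>, so by the Plancherel bound their Fourier integrals form a Cauchy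
  family; completeness provides the limit. Hence the choice in the definition of \<open>fourier_L2\<close> is not vacuous.
\<close>

theorem is_fourier_L2_fourier_L2:
  fixes f :: "real^'n \<Rightarrow> complex"
  assumes f: "in_Lp 2 f"
  shows "is_fourier_L2 f (fourier_L2 f)"
proof -
  let ?T = "\<lambda>R. truncate R f"
  let ?F = "\<lambda>R. fourier_L1 (truncate R f)"
  have T2: "in_Lp 2 (?T R)" and T1: "integrable lebesgue (?T R)" for R
    using in_Lp_truncate[OF _ f] integrable_truncate_L2[OF f] by simp_all
  have F2: "in_Lp 2 (?F R)" for R
    by (rule fourier_L1_L2_bound(1)[OF T1 T2])
  define d where "d R = Lp_norm 2 (\<lambda>x. ?T R x - f x)" for R
  have d: "(d \<longlongrightarrow> 0) at_top"
    unfolding d_def by (rule Lp_norm_truncate_diff_tendsto[OF f])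
  have FF: "Lp_norm 2 (\<lambda>\<xi>. ?F R \<xi> - ?F S \<xi>) \<le> d R + d S" for R S
  proof -
    have "Lp_norm 2 (\<lambda>\<xi>. ?F R \<xi> - ?F S \<xi>) \<le> Lp_norm 2 (\<lambda>x. ?T R x - ?T S x)"
      unfolding fourier_L1_diff[OF T1 T1, symmetric]
      by (rule fourier_L1_L2_bound(2)[OF Bochner_Integration.integrable_diff[OF T1 T1] Lp_norm_diff(1)[OF _ T2 T2]]) simp
    also have "\<dots> \<le> d R + Lp_norm 2 (\<lambda>x. f x - ?T S x)"
      unfolding d_def by (rule Lp_norm_diff_triangle) (use T2 f in auto)
    finally show ?thesis
      unfolding d_def Lp_norm_minus_commute[of 2 f] .
  qed
  have dn: "(\<lambda>n. d (real n)) \<longlonglongrightarrow> 0"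
    using filterlim_compose[OF d filterlim_real_sequentially] .
  have "\<exists>N. \<forall>m\<ge>N. \<forall>n\<ge>N. Lp_norm 2 (\<lambda>\<xi>. ?F (real m) \<xi> - ?F (real n) \<xi>) < e" if "e > 0" for e
  proof -
    obtain N where N: "\<And>n. n \<ge> N \<Longrightarrow> d (real n) < e / 2"
      using order_tendstoD(2)[OF dn, of "e / 2"] \<open>e > 0\<close> by (auto simp: eventually_sequentially)
    have "Lp_norm 2 (\<lambda>\<xi>. ?F (real m) \<xi> - ?F (real n) \<xi>) < e" if "m \<ge> N" "n \<ge> N" for m n
      using FF[of "real m" "real n"] N[OF that(1)] N[OF that(2)] by linarith
    then show ?thesis by blast
  qed
  from L2_complete[OF F2 this] obtain g where g: "in_Lp 2 g"
    and lim: "(\<lambda>n. Lp_norm 2 (\<lambda>\<xi>. ?F (real n) \<xi> - g \<xi>)) \<longlonglongrightarrow> 0"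
    by blast
  have le: "Lp_norm 2 (\<lambda>\<xi>. ?F R \<xi> - g \<xi>) \<le> d R" for R
  proof (rule LIMSEQ_le_const)
    show "(\<lambda>n. d R + d (real n) + Lp_norm 2 (\<lambda>\<xi>. ?F (real n) \<xi> - g \<xi>)) \<longlonglongrightarrow> d R"
      using tendsto_add[OF tendsto_add[OF tendsto_const[of "d R"] dn] lim] by simp
    have "Lp_norm 2 (\<lambda>\<xi>. ?F R \<xi> - g \<xi>) \<le> d R + d (real n) + Lp_norm 2 (\<lambda>\<xi>. ?F (real n) \<xi> - g \<xi>)" for n
      using Lp_norm_diff_triangle[OF _ F2[of R] F2[of "real n"] g] FF[of R "real n"] by simp
    then show "\<exists>N. \<forall>n\<ge>N. Lp_norm 2 (\<lambda>\<xi>. ?F R \<xi> - g \<xi>) \<le> d R + d (real n) + Lp_norm 2 (\<lambda>\<xi>. ?F (real n) \<xi> - g \<xi>)"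
      by blast
  qed
  have "((\<lambda>R. Lp_norm 2 (\<lambda>\<xi>. ?F R \<xi> - g \<xi>)) \<longlongrightarrow> 0) at_top"
    by (rule tendsto_sandwich[OF _ _ tendsto_const d]) (simp_all add: le Lp_norm_nonneg)
  then have "is_fourier_L2 f g"
    using g by (simp add: is_fourier_L2_iff[OF f])
  then show ?thesis
    unfolding fourier_L2_def by (rule someI[of "is_fourier_L2 f"])
qed

lemma in_Lp_fourier_L2: "in_Lp 2 f \<Longrightarrow> in_Lp 2 (fourier_L2 f)"
  using is_fourier_L2_fourier_L2 by (auto simp: is_fourier_L2_def)

text \<open>
  Conjugation carries every bound for the Fourier transform over to its inverse.
\<close>

lemma inv_fourier_L1_eq_cnj: "inv_fourier_L1 v x = cnj (fourier_L1 (\<lambda>\<xi>. cnj (v \<xi>)) x)"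
  unfolding inv_fourier_L1_def fourier_L1_def
  by (simp add: inner_commute cis_cnj flip: Bochner_Integration.integral_cnj)

lemma inv_fourier_L1_L2_bound:
  fixes v :: "real^'n \<Rightarrow> complex"
  assumes v: "integrable lebesgue v" and v2: "in_Lp 2 v"
  shows "in_Lp 2 (inv_fourier_L1 v)" and "Lp_norm 2 (inv_fourier_L1 v) \<le> Lp_norm 2 v"
proof -
  have norm: "norm (inv_fourier_L1 v x) = norm (fourier_L1 (\<lambda>\<xi>. cnj (v \<xi>)) x)" for x
    by (simp add: inv_fourier_L1_eq_cnj)
  have cv: "integrable lebesgue (\<lambda>\<xi>. cnj (v \<xi>))"
    using v by simp
  have [measurable]: "v \<in> borel_measurable lebesgue"
    using v by (rule borel_measurable_integrable)
  have cv2: "in_Lp 2 (\<lambda>\<xi>. cnj (v \<xi>))" "Lp_norm 2 (\<lambda>\<xi>. cnj (v \<xi>)) = Lp_norm 2 v"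
    using v2 borel_measurable_integrable[OF cv] by (simp_all add: in_Lp_def Lp_norm_def)
  have [measurable]: "fourier_L1 (\<lambda>\<xi>. cnj (v \<xi>)) \<in> borel_measurable lebesgue"
    by (rule measurable_fourier_L1[OF cv])
  have "inv_fourier_L1 v \<in> borel_measurable lebesgue"
    unfolding inv_fourier_L1_eq_cnj[abs_def] by measurable
  then show "in_Lp 2 (inv_fourier_L1 v)"
    using fourier_L1_L2_bound(1)[OF cv cv2(1)] by (simp add: in_Lp_def norm)
  show "Lp_norm 2 (inv_fourier_L1 v) \<le> Lp_norm 2 v"
    using fourier_L1_L2_bound(2)[OF cv cv2(1)] by (simp add: Lp_norm_def norm flip: cv2(2))
qed

lemma integrable_mult_cnj:
  assumes "in_Lp 2 f" "in_Lp 2 g"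
  shows "integrable lebesgue (\<lambda>x. f x * cnj (g x))"
proof -
  have [measurable]: "g \<in> borel_measurable lebesgue"
    using assms by (auto simp: in_Lp_def)
  have "in_Lp 2 (\<lambda>x. cnj (g x))"
    using assms(2) by (simp add: in_Lp_def)
  then show ?thesis
    using integrable_mult_L2(1)[OF assms(1)] by blast
qed

lemma L2_norm_diff_power2:
  assumes f: "in_Lp 2 f" and g: "in_Lp 2 g"
  shows "(Lp_norm 2 (\<lambda>x. f x - g x))\<^sup>2 = (Lp_norm 2 f)\<^sup>2 + (Lp_norm 2 g)\<^sup>2 - 2 * Re (\<integral>x. f x * cnj (g x) \<partial>lebesgue)"
proof -
  define r where "r x = Re (f x * cnj (g x))" for x
  have int: "integrable lebesgue (\<lambda>x. (norm (f x))\<^sup>2)" "integrable lebesgue (\<lambda>x. (norm (g x))\<^sup>2)"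
    "integrable lebesgue r"
    using f g integrable_Re[OF integrable_mult_cnj[OF f g]] by (auto simp: in_Lp_2_iff r_def[abs_def])
  have "(norm (f x - g x))\<^sup>2 = (norm (f x))\<^sup>2 + (norm (g x))\<^sup>2 - 2 * r x" for x
    unfolding cmod_power2 r_def by (simp add: power2_eq_square algebra_simps)
  then have "(Lp_norm 2 (\<lambda>x. f x - g x))\<^sup>2 = (Lp_norm 2 f)\<^sup>2 + (Lp_norm 2 g)\<^sup>2 - 2 * (\<integral>x. r x \<partial>lebesgue)"
    using int by (simp add: Lp_norm_2_power2)
  also have "(\<integral>x. r x \<partial>lebesgue) = Re (\<integral>x. f x * cnj (g x) \<partial>lebesgue)"
    unfolding r_def by (rule integral_Re[OF integrable_mult_cnj[OF f g]])
  finally show ?thesis .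
qed

lemma fourier_L1_duality:
  fixes v h :: "real^'n \<Rightarrow> complex"
  assumes v: "integrable lebesgue v" and h: "integrable lebesgue h"
  shows "(\<integral>x. inv_fourier_L1 v x * cnj (h x) \<partial>lebesgue) = (\<integral>\<xi>. v \<xi> * cnj (fourier_L1 h \<xi>) \<partial>lebesgue)"
proof -
  let ?c = "complex_of_real (fourier_const TYPE('n))"
  have cv: "integrable lebesgue (\<lambda>\<xi>. cnj (v \<xi>))"
    using v by simp
  obtain g where g: "integrable lborel g" and gm[measurable]: "g \<in> borel_measurable borel"
    and gae: "AE x in lebesgue. h x = g x"
    and geq: "fourier_L1 h = (\<lambda>\<xi>. ?c * fourier_integral g \<xi>)"
    by (rule integrable_borel_representative[OF h])
  obtain u where u: "integrable lborel u" and um[measurable]: "u \<in> borel_measurable borel"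
    and uae: "AE x in lebesgue. cnj (v x) = u x"
    and ueq: "fourier_L1 (\<lambda>\<xi>. cnj (v \<xi>)) = (\<lambda>\<xi>. ?c * fourier_integral u \<xi>)"
    by (rule integrable_borel_representative[OF cv])
  have [measurable]: "h \<in> borel_measurable lebesgue" "v \<in> borel_measurable lebesgue"
    "g \<in> borel_measurable lebesgue" "u \<in> borel_measurable lebesgue"
    "fourier_integral g \<in> borel_measurable lebesgue" "fourier_integral u \<in> borel_measurable lebesgue"
    using v h by (auto intro!: measurable_completion)
  have "(\<integral>x. inv_fourier_L1 v x * cnj (h x) \<partial>lebesgue) = (\<integral>x. ?c * (cnj (fourier_integral u x) * cnj (g x)) \<partial>lebesgue)"
    unfolding inv_fourier_L1_eq_cnj ueq
    by (rule integral_cong_AE) (use gae in \<open>auto elim: eventually_mono\<close>)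
  also have "\<dots> = (\<integral>x. ?c * (cnj (fourier_integral u x) * cnj (g x)) \<partial>lborel)"
    by (rule integral_completion) measurable
  also have "\<dots> = ?c * (\<integral>x. cnj (g x) * (\<integral>\<xi>. cis (\<xi> \<bullet> x) * cnj (u \<xi>) \<partial>lborel) \<partial>lborel)"
    by (simp add: cnj_fourier_integral mult.commute)
  also have "(\<integral>x. cnj (g x) * (\<integral>\<xi>. cis (\<xi> \<bullet> x) * cnj (u \<xi>) \<partial>lborel) \<partial>lborel)
      = (\<integral>\<xi>. (\<integral>x. cis (\<xi> \<bullet> x) * cnj (g x) \<partial>lborel) * cnj (u \<xi>) \<partial>lborel)"
    by (rule bounded_kernel_Fubini) (use g u in auto)
  also have "?c * \<dots> = (\<integral>\<xi>. ?c * (cnj (u \<xi>) * cnj (fourier_integral g \<xi>)) \<partial>lborel)"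
    by (simp add: cnj_fourier_integral mult.commute inner_commute)
  also have "\<dots> = (\<integral>\<xi>. ?c * (cnj (u \<xi>) * cnj (fourier_integral g \<xi>)) \<partial>lebesgue)"
    by (rule integral_completion[symmetric]) measurable
  also have "\<dots> = (\<integral>\<xi>. v \<xi> * cnj (fourier_L1 h \<xi>) \<partial>lebesgue)"
  proof -
    have vu: "AE x in lebesgue. cnj (u x) = v x"
      using uae by eventually_elim (metis complex_cnj_cnj)
    show ?thesis
      unfolding geq by (rule integral_cong_AE) (use vu in \<open>auto elim: eventually_mono\<close>)
  qed
  finally show ?thesis .
qed

text \<open>
  Expand both squares. The inner products agree by duality, \<open>\<parallel>h\<parallel> = \<parallel>F h\<parallel>\<close> by Plancherel, and the inverse
  transform does not increase the norm of \<open>v\<close>.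
\<close>

lemma inv_fourier_L1_approx_L1:
  fixes v h :: "real^'n \<Rightarrow> complex"
  assumes v: "integrable lebesgue v" "in_Lp 2 v" and h: "integrable lebesgue h" "in_Lp 2 h"
  shows "Lp_norm 2 (\<lambda>x. inv_fourier_L1 v x - h x) \<le> Lp_norm 2 (\<lambda>\<xi>. v \<xi> - fourier_L1 h \<xi>)"
proof (rule power2_le_imp_le)
  have "(Lp_norm 2 (inv_fourier_L1 v))\<^sup>2 \<le> (Lp_norm 2 v)\<^sup>2"
    by (intro power_mono inv_fourier_L1_L2_bound v Lp_norm_nonneg)
  then show "(Lp_norm 2 (\<lambda>x. inv_fourier_L1 v x - h x))\<^sup>2 \<le> (Lp_norm 2 (\<lambda>\<xi>. v \<xi> - fourier_L1 h \<xi>))\<^sup>2"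
    unfolding L2_norm_diff_power2[OF inv_fourier_L1_L2_bound(1)[OF v] h(2)]
      L2_norm_diff_power2[OF v(2) fourier_L1_L2_bound(1)[OF h]]
      fourier_L1_duality[OF v(1) h(1)] Plancherel_L1_L2[OF h]
    by simp
qed (rule Lp_norm_nonneg)

text \<open>
  Fourier inversion in quantitative form: if \<open>v\<close> is close to the transform of \<open>f\<close>, then its inverse transform is
  close to \<open>f\<close>. With \<open>v\<close> a frequency cut-off of the transform, this is the convergence of the
  Littlewood--Paley expansion; with \<open>v = 0\<close>, it bounds \<open>f\<close> by its transform.
\<close>

theorem inv_fourier_L1_approx:
  fixes v f :: "real^'n \<Rightarrow> complex"
  assumes v: "integrable lebesgue v" "in_Lp 2 v" and f: "in_Lp 2 f"
  shows "Lp_norm 2 (\<lambda>x. inv_fourier_L1 v x - f x) \<le> Lp_norm 2 (\<lambda>\<xi>. v \<xi> - fourier_L2 f \<xi>)"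
proof -
  let ?T = "\<lambda>R. truncate R f"
  let ?g = "fourier_L2 f"
  have T2: "in_Lp 2 (?T R)" and T1: "integrable lebesgue (?T R)" for R
    using in_Lp_truncate[OF _ f] integrable_truncate_L2[OF f] by simp_all
  have F2: "in_Lp 2 (fourier_L1 (?T R))" for R
    by (rule fourier_L1_L2_bound(1)[OF T1 T2])
  have g: "in_Lp 2 ?g" and lim: "((\<lambda>R. Lp_norm 2 (\<lambda>\<xi>. fourier_L1 (?T R) \<xi> - ?g \<xi>)) \<longlongrightarrow> 0) at_top"
    using is_fourier_L2_fourier_L2[OF f] by (auto simp: is_fourier_L2_iff[OF f])
  have lim_sum: "((\<lambda>R. Lp_norm 2 (\<lambda>\<xi>. v \<xi> - ?g \<xi>) + Lp_norm 2 (\<lambda>\<xi>. fourier_L1 (?T R) \<xi> - ?g \<xi>)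
      + Lp_norm 2 (\<lambda>x. ?T R x - f x)) \<longlongrightarrow> Lp_norm 2 (\<lambda>\<xi>. v \<xi> - ?g \<xi>) + 0 + 0) at_top"
    by (intro tendsto_add tendsto_const lim Lp_norm_truncate_diff_tendsto f)
  have est: "Lp_norm 2 (\<lambda>x. inv_fourier_L1 v x - f x) \<le> Lp_norm 2 (\<lambda>\<xi>. v \<xi> - ?g \<xi>)
      + Lp_norm 2 (\<lambda>\<xi>. fourier_L1 (?T R) \<xi> - ?g \<xi>) + Lp_norm 2 (\<lambda>x. ?T R x - f x)" for R
  proof -
    have "Lp_norm 2 (\<lambda>x. inv_fourier_L1 v x - f x)
        \<le> Lp_norm 2 (\<lambda>x. inv_fourier_L1 v x - ?T R x) + Lp_norm 2 (\<lambda>x. ?T R x - f x)"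
      by (rule Lp_norm_diff_triangle) (use inv_fourier_L1_L2_bound(1)[OF v] T2 f in auto)
    moreover have "Lp_norm 2 (\<lambda>x. inv_fourier_L1 v x - ?T R x) \<le> Lp_norm 2 (\<lambda>\<xi>. v \<xi> - fourier_L1 (?T R) \<xi>)"
      by (rule inv_fourier_L1_approx_L1[OF v T1 T2])
    moreover have "Lp_norm 2 (\<lambda>\<xi>. v \<xi> - fourier_L1 (?T R) \<xi>)
        \<le> Lp_norm 2 (\<lambda>\<xi>. v \<xi> - ?g \<xi>) + Lp_norm 2 (\<lambda>\<xi>. ?g \<xi> - fourier_L1 (?T R) \<xi>)"
      by (rule Lp_norm_diff_triangle) (use v g F2 in auto)
    ultimately show ?thesis
      using Lp_norm_minus_commute[of 2 ?g "fourier_L1 (?T R)"] by linarith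
  qed
  have "Lp_norm 2 (\<lambda>x. inv_fourier_L1 v x - f x) \<le> Lp_norm 2 (\<lambda>\<xi>. v \<xi> - ?g \<xi>) + 0 + 0"
    by (rule tendsto_lowerbound[OF lim_sum always_eventually[OF allI[OF est]] trivial_limit_at_top_linorder])
  then show ?thesis by simp
qed

section \<open>Littlewood--Paley blocks\<close>

text \<open>
  The symbols of the dyadic blocks, shifted by one: index \<open>n\<close> belongs to the block \<open>j = n - 1\<close>, so that sums over
  blocks become sums over an initial segment of the natural numbers.
\<close>

definition LP_symbol :: "(real^'n \<Rightarrow> real) \<Rightarrow> (real^'n \<Rightarrow> real) \<Rightarrow> nat \<Rightarrow> real^'n \<Rightarrow> real" where
  "LP_symbol chi \<phi> n \<xi> = (case n of 0 \<Rightarrow> chi \<xi> | Suc j \<Rightarrow> \<phi> ((1 / 2 ^ j) *\<^sub>R \<xi>))"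

lemma LP_block_eq_symbol:
  "LP_block chi \<phi> (int n - 1) f = fourier_multiplier (LP_symbol chi \<phi> n) f"
proof (cases n)
  case (Suc j)
  have "2 powr (- real j) = 1 / 2 ^ j"
    by (simp add: powr_minus powr_realpow divide_inverse)
  then show ?thesis
    using Suc by (simp add: LP_block_def LP_symbol_def[abs_def])
qed (simp add: LP_block_def LP_symbol_def[abs_def])

lemma schwartz_imp_continuous:
  assumes "schwartz f"
  shows "continuous_on UNIV f"
proof -
  have "partial_derivs [] f differentiable (at x)" for x
    using assms unfolding schwartz_def by blast
  then have "f differentiable (at x)" for x
    by (simp add: partial_derivs_def)
  then show ?thesis
    by (simp add: continuous_at_imp_continuous_on differentiable_imp_continuous_within)
qed

lemma LP_symbol_nonneg: "dyadic_partition chi \<phi> \<Longrightarrow> 0 \<le> LP_symbol chi \<phi> n \<xi>"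
  by (cases n) (auto simp: dyadic_partition_def LP_symbol_def)

lemma LP_symbol_sums_1:
  assumes "dyadic_partition chi \<phi>"
  shows "(\<lambda>n. LP_symbol chi \<phi> n \<xi>) sums 1"
proof -
  have "summable (\<lambda>j::nat. \<phi> ((1 / 2 ^ j) *\<^sub>R \<xi>))"
    and one: "chi \<xi> + (\<Sum>j::nat. \<phi> ((1 / 2 ^ j) *\<^sub>R \<xi>)) = 1"
    using assms by (auto simp: dyadic_partition_def)
  then have "(\<lambda>j. LP_symbol chi \<phi> (Suc j) \<xi>) sums (\<Sum>j::nat. \<phi> ((1 / 2 ^ j) *\<^sub>R \<xi>))"
    by (simp add: LP_symbol_def summable_sums)
  from sums_Suc[OF this] show ?thesis
    using one by (simp add: LP_symbol_def add.commute)
qed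

lemma LP_symbol_sum_le_1:
  assumes "dyadic_partition chi \<phi>"
  shows "(\<Sum>n<N. LP_symbol chi \<phi> n \<xi>) \<le> 1"
  using LP_symbol_sums_1[OF assms, of \<xi>] sum_le_suminf[of "\<lambda>n. LP_symbol chi \<phi> n \<xi>" "{..<N}"]
    LP_symbol_nonneg[OF assms] by (auto simp: sums_iff)

lemma LP_symbol_le_1:
  assumes "dyadic_partition chi \<phi>"
  shows "LP_symbol chi \<phi> n \<xi> \<le> 1"
proof -
  have "LP_symbol chi \<phi> n \<xi> \<le> (\<Sum>i<Suc n. LP_symbol chi \<phi> i \<xi>)"
    by (rule member_le_sum) (auto simp: LP_symbol_nonneg[OF assms])
  also have "\<dots> \<le> 1"
    by (rule LP_symbol_sum_le_1[OF assms])
  finally show ?thesis .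
qed

lemma measurable_LP_symbol:
  assumes "dyadic_partition chi \<phi>"
  shows "LP_symbol chi \<phi> n \<in> borel_measurable lebesgue"
proof -
  have "continuous_on UNIV chi" and \<phi>: "continuous_on UNIV \<phi>"
    using assms by (auto simp: dyadic_partition_def intro: schwartz_imp_continuous)
  moreover have "continuous_on UNIV (\<lambda>\<xi>. \<phi> ((1 / 2 ^ j) *\<^sub>R \<xi>))" for j :: nat
    by (rule continuous_on_compose2[OF \<phi>]) (auto intro!: continuous_intros)
  ultimately have "continuous_on UNIV (LP_symbol chi \<phi> n)"
    by (cases n) (simp_all add: LP_symbol_def[abs_def])
  then show ?thesis
    by (rule borel_measurable_lebesgue_continuous)
qed

text \<open>
  The lower bound is stated in the form \<open>(3/4 \<cdot> 2\<^sup>j)\<^sup>2 \<le> 1 + |\<xi>|\<^sup>2\<close>, which also holds for the low-frequency block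
  \<open>j = -1\<close>. It thus needs no separate treatment below.
\<close>

lemma LP_symbol_support:
  assumes dp: "dyadic_partition chi \<phi>" and nz: "LP_symbol chi \<phi> n \<xi> \<noteq> 0"
  shows "norm \<xi> \<le> 8 / 3 * 2 ^ n" and "(3 / 4 * 2 powr (real n - 1))\<^sup>2 \<le> 1 + (norm \<xi>)\<^sup>2"
proof -
  have chi: "norm \<eta> \<le> 4 / 3" if "chi \<eta> \<noteq> 0" for \<eta>
    using dp that closure_subset[of "{\<xi>. chi \<xi> \<noteq> 0}"] unfolding dyadic_partition_def by blast
  have \<phi>: "3 / 4 \<le> norm \<eta> \<and> norm \<eta> \<le> 8 / 3" if "\<phi> \<eta> \<noteq> 0" for \<eta>
    using dp that closure_subset[of "{\<xi>. \<phi> \<xi> \<noteq> 0}"] unfolding dyadic_partition_def by blast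
  have "norm \<xi> \<le> 8 / 3 * 2 ^ n \<and> (3 / 4 * 2 powr (real n - 1))\<^sup>2 \<le> 1 + (norm \<xi>)\<^sup>2"
  proof (cases n)
    case 0
    have "(3 / 4 * 2 powr (real n - 1))\<^sup>2 \<le> (1 :: real)"
      using 0 by (simp add: powr_minus power2_eq_square)
    moreover have "norm \<xi> \<le> 4 / 3"
      using nz chi 0 by (simp add: LP_symbol_def)
    ultimately show ?thesis
      using 0 by (simp add: add_increasing2)
  next
    case (Suc j)
    have "3 / 4 \<le> norm ((1 / 2 ^ j) *\<^sub>R \<xi>) \<and> norm ((1 / 2 ^ j) *\<^sub>R \<xi>) \<le> 8 / 3"
      using nz by (intro \<phi>) (simp add: LP_symbol_def Suc)
    then have b: "3 / 4 * 2 ^ j \<le> norm \<xi>" "norm \<xi> \<le> 8 / 3 * 2 ^ j"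
      by (simp_all add: field_simps)
    have "norm \<xi> \<le> 8 / 3 * 2 ^ n"
      using b(2) by (rule order_trans) (simp add: Suc)
    moreover have eq: "2 powr (real n - 1) = 2 ^ j"
      by (simp add: Suc powr_realpow)
    moreover have "(3 / 4 * 2 ^ j)\<^sup>2 \<le> (norm \<xi>)\<^sup>2"
      using b(1) by (intro power_mono) auto
    ultimately show ?thesis
      unfolding eq by (intro conjI) linarith+
  qed
  then show "norm \<xi> \<le> 8 / 3 * 2 ^ n" and "(3 / 4 * 2 powr (real n - 1))\<^sup>2 \<le> 1 + (norm \<xi>)\<^sup>2"
    by auto
qed

lemma multiplier_symbol_integrable:
  fixes f :: "real^'n \<Rightarrow> complex"
  assumes [measurable]: "m \<in> borel_measurable lebesgue" and m: "\<And>\<xi>. \<bar>m \<xi>\<bar> \<le> 1"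
    and supp: "\<And>\<xi>. m \<xi> \<noteq> 0 \<Longrightarrow> norm \<xi> \<le> R" and g: "in_Lp 2 g"
  shows "in_Lp 2 (\<lambda>\<xi>. complex_of_real (m \<xi>) * g \<xi>)" and "integrable lebesgue (\<lambda>\<xi>. complex_of_real (m \<xi>) * g \<xi>)"
proof -
  have [measurable]: "g \<in> borel_measurable lebesgue"
    using g by (auto simp: in_Lp_def)
  show *: "in_Lp 2 (\<lambda>\<xi>. complex_of_real (m \<xi>) * g \<xi>)"
  proof (rule in_Lp_mono(1)[OF _ g])
    show "AE \<xi> in lebesgue. norm (complex_of_real (m \<xi>) * g \<xi>) \<le> norm (g \<xi>)"
      using m by (intro AE_I2) (simp add: norm_mult mult_left_le_one_le)
  qed simp_all
  have "truncate R (\<lambda>\<xi>. complex_of_real (m \<xi>) * g \<xi>) = (\<lambda>\<xi>. complex_of_real (m \<xi>) * g \<xi>)"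
    using supp by (auto simp: truncate_def fun_eq_iff)
  then show "integrable lebesgue (\<lambda>\<xi>. complex_of_real (m \<xi>) * g \<xi>)"
    using integrable_truncate_L2[OF *, of R] by simp
qed

lemma inv_fourier_L1_sum:
  fixes v :: "'i \<Rightarrow> real^'n \<Rightarrow> complex"
  assumes "\<And>i. i \<in> I \<Longrightarrow> integrable lebesgue (v i)"
  shows "inv_fourier_L1 (\<lambda>\<xi>. \<Sum>i\<in>I. v i \<xi>) x = (\<Sum>i\<in>I. inv_fourier_L1 (v i) x)"
proof -
  have "integrable lebesgue (\<lambda>\<xi>. cis (x \<bullet> \<xi>) * v i \<xi>)" if "i \<in> I" for i
    using integrable_lebesgue_cis_mult(1)[OF assms[OF that], of x] by (simp add: inner_commute)
  then show ?thesis
    by (simp add: inv_fourier_L1_def sum_distrib_left Bochner_Integration.integral_sum)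
qed

text \<open>
  Hoelder between \<open>L\<^sup>2\<close> and \<open>L\<^sup>\<infinity>\<close>, from \<open>|u|\<^sup>p \<le> K\<^sup>p\<^sup>-\<^sup>2 |u|\<^sup>2\<close>.
\<close>

lemma Lp_interpolation_2_infinity:
  fixes u :: "real^'n \<Rightarrow> complex"
  assumes u: "in_Lp 2 u" and K: "AE x in lebesgue. norm (u x) \<le> K" "K \<ge> 0" and p: "p > 2"
  shows "in_Lp p u" and "Lp_norm p u \<le> K powr (1 - 2 / p) * Lp_norm 2 u powr (2 / p)"
proof -
  have [measurable]: "u \<in> borel_measurable lebesgue"
    using u by (auto simp: in_Lp_def)
  have "(\<integral>\<^sup>+x. ennreal (norm (u x) powr p) \<partial>lebesgue)
      \<le> (\<integral>\<^sup>+x. ennreal (K powr (p - 2)) * ennreal ((norm (u x))\<^sup>2) \<partial>lebesgue)"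
  proof (rule nn_integral_mono_AE)
    show "AE x in lebesgue. ennreal (norm (u x) powr p) \<le> ennreal (K powr (p - 2)) * ennreal ((norm (u x))\<^sup>2)"
      using K(1)
    proof eventually_elim
      case (elim x)
      have "norm (u x) powr p = norm (u x) powr (p - 2) * (norm (u x))\<^sup>2"
        by (cases "u x = 0") (simp_all add: powr_diff)
      also have "\<dots> \<le> K powr (p - 2) * (norm (u x))\<^sup>2"
        using elim p by (intro mult_right_mono powr_mono2) auto
      finally show ?case
        by (simp add: ennreal_leI flip: ennreal_mult)
    qed
  qed
  also have "\<dots> = ennreal (K powr (p - 2) * (Lp_norm 2 u)\<^sup>2)"
    using u by (simp add: nn_integral_cmult nn_integral_power2_eq_Lp_norm ennreal_mult)
  also have "K powr (p - 2) * (Lp_norm 2 u)\<^sup>2 = (K powr (1 - 2 / p) * Lp_norm 2 u powr (2 / p)) powr p"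
    using p by (simp add: powr_mult powr_powr Lp_norm_nonneg left_diff_distrib)
  finally have le: "(\<integral>\<^sup>+x. ennreal (norm (u x) powr p) \<partial>lebesgue)
      \<le> ennreal ((K powr (1 - 2 / p) * Lp_norm 2 u powr (2 / p)) powr p)" .
  show "in_Lp p u" "Lp_norm p u \<le> K powr (1 - 2 / p) * Lp_norm 2 u powr (2 / p)"
    using Lp_norm_leI[OF _ _ _ le] p by simp_all
qed

text \<open>
  On the support of the symbol, \<open>1 + |\<xi>|\<^sup>2\<close> is at least \<open>(3/4 \<cdot> 2\<^sup>j)\<^sup>2\<close>, so the weight of \<open>H\<^sup>k\<close> gains a factor \<open>2\<^sup>-\<^sup>j\<^sup>k\<close>
  up to a constant.
\<close>

lemma LP_block_L2_bound:
  fixes f :: "real^'n \<Rightarrow> complex"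
  assumes dp: "dyadic_partition chi \<phi>" and f: "in_H k f"
  shows "in_Lp 2 (fourier_multiplier (LP_symbol chi \<phi> n) f)"
    and "Lp_norm 2 (fourier_multiplier (LP_symbol chi \<phi> n) f) \<le> (4 / 3) ^ k * 2 powr (- (real k * (real n - 1))) * H_norm k f"
proof -
  have f2: "in_Lp 2 f" and int: "integrable lebesgue (\<lambda>\<xi>. (1 + (norm \<xi>)\<^sup>2) ^ k * (norm (fourier_L2 f \<xi>))\<^sup>2)"
    using f by (auto simp: in_H_def)
  define \<mu> where "\<mu> = 3 / 4 * 2 powr (real n - 1)"
  have \<mu>: "\<mu> > 0"
    by (simp add: \<mu>_def)
  define v where "v \<xi> = complex_of_real (LP_symbol chi \<phi> n \<xi>) * fourier_L2 f \<xi>" for \<xi>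
  have m: "\<bar>LP_symbol chi \<phi> n \<xi>\<bar> \<le> 1" for \<xi>
    using LP_symbol_le_1[OF dp] LP_symbol_nonneg[OF dp] by simp
  have v: "in_Lp 2 v" "integrable lebesgue v"
    using multiplier_symbol_integrable[OF measurable_LP_symbol[OF dp] m LP_symbol_support(1)[OF dp] in_Lp_fourier_L2[OF f2]]
    unfolding v_def[abs_def] by blast+
  have eq: "fourier_multiplier (LP_symbol chi \<phi> n) f = inv_fourier_L1 v"
    by (simp add: fourier_multiplier_def v_def[abs_def])
  show "in_Lp 2 (fourier_multiplier (LP_symbol chi \<phi> n) f)"
    unfolding eq by (rule inv_fourier_L1_L2_bound(1)[OF v(2,1)])
  have pw: "(norm (v \<xi>))\<^sup>2 * (\<mu>\<^sup>2) ^ k \<le> (1 + (norm \<xi>)\<^sup>2) ^ k * (norm (fourier_L2 f \<xi>))\<^sup>2" for \<xi>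
  proof (cases "LP_symbol chi \<phi> n \<xi> = 0")
    case False
    have "norm (v \<xi>) \<le> norm (fourier_L2 f \<xi>)"
      unfolding v_def using m[of \<xi>] by (simp add: norm_mult mult_left_le_one_le)
    then have "(norm (v \<xi>))\<^sup>2 \<le> (norm (fourier_L2 f \<xi>))\<^sup>2"
      by (rule power_mono) simp
    moreover have "(\<mu>\<^sup>2) ^ k \<le> (1 + (norm \<xi>)\<^sup>2) ^ k"
      using LP_symbol_support(2)[OF dp False] unfolding \<mu>_def by (rule power_mono) simp
    ultimately have "(norm (v \<xi>))\<^sup>2 * (\<mu>\<^sup>2) ^ k \<le> (norm (fourier_L2 f \<xi>))\<^sup>2 * (1 + (norm \<xi>)\<^sup>2) ^ k"
      by (rule mult_mono) simp_all
    then show ?thesis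
      by (simp add: mult.commute)
  qed (simp add: v_def)
  have "(Lp_norm 2 v)\<^sup>2 * (\<mu>\<^sup>2) ^ k = (\<integral>\<xi>. (norm (v \<xi>))\<^sup>2 * (\<mu>\<^sup>2) ^ k \<partial>lebesgue)"
    by (simp add: Lp_norm_2_power2)
  also have "\<dots> \<le> (\<integral>\<xi>. (1 + (norm \<xi>)\<^sup>2) ^ k * (norm (fourier_L2 f \<xi>))\<^sup>2 \<partial>lebesgue)"
    by (rule integral_mono[OF _ int pw]) (use v in \<open>simp add: in_Lp_2_iff\<close>)
  also have "\<dots> = (H_norm k f)\<^sup>2"
    by (simp add: H_norm_def)
  finally have "(Lp_norm 2 v * \<mu> ^ k)\<^sup>2 \<le> (H_norm k f)\<^sup>2"
    by (simp add: power_mult_distrib mult.commute[of k] flip: power_mult)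
  moreover have "H_norm k f \<ge> 0"
    by (simp add: H_norm_def)
  ultimately have "Lp_norm 2 v * \<mu> ^ k \<le> H_norm k f"
    by (rule power2_le_imp_le)
  then have "Lp_norm 2 v \<le> (1 / \<mu> ^ k) * H_norm k f"
    using \<mu> by (simp add: field_simps)
  also have "1 / \<mu> ^ k = (4 / 3) ^ k * 2 powr (- (real k * (real n - 1)))"
  proof -
    have "\<mu> ^ k = (3 / 4) ^ k * 2 powr (real k * (real n - 1))"
      unfolding \<mu>_def power_mult_distrib by (simp add: powr_powr mult.commute flip: powr_realpow)
    moreover have "inverse ((3 / 4 :: real) ^ k) = (4 / 3) ^ k"
      by (simp add: power_inverse[symmetric])
    ultimately show ?thesis
      by (simp only: powr_minus inverse_mult_distrib inverse_eq_divide[symmetric])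
  qed
  finally have "Lp_norm 2 v \<le> (4 / 3) ^ k * 2 powr (- (real k * (real n - 1))) * H_norm k f" .
  moreover have "Lp_norm 2 (fourier_multiplier (LP_symbol chi \<phi> n) f) \<le> Lp_norm 2 v"
    unfolding eq by (rule inv_fourier_L1_L2_bound(2)[OF v(2,1)])
  ultimately show "Lp_norm 2 (fourier_multiplier (LP_symbol chi \<phi> n) f) \<le> (4 / 3) ^ k * 2 powr (- (real k * (real n - 1))) * H_norm k f"
    by simp
qed

lemma LP_block_Linf_bound:
  assumes "besov_norm chi \<phi> (- s) f < \<infinity>"
  shows "AE x in lebesgue. norm (fourier_multiplier (LP_symbol chi \<phi> n) f x)
    \<le> 2 powr ((real n - 1) * s) * enn2real (besov_norm chi \<phi> (- s) f)"
proof -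
  define B where "B = enn2real (besov_norm chi \<phi> (- s) f)"
  let ?u = "fourier_multiplier (LP_symbol chi \<phi> n) f"
  let ?j = "real n - 1"
  have B: "besov_norm chi \<phi> (- s) f = ennreal B"
    using assms unfolding B_def by (simp add: less_top)
  have "ennreal (2 powr (real_of_int (int n - 1) * (- s))) * Linf_norm (LP_block chi \<phi> (int n - 1) f)
      \<le> besov_norm chi \<phi> (- s) f"
    unfolding besov_norm_def by (rule SUP_upper) simp
  then have le: "ennreal (2 powr (- (?j * s))) * Linf_norm ?u \<le> ennreal B"
    unfolding B LP_block_eq_symbol by simp
  have "Linf_norm ?u = ennreal (2 powr (?j * s)) * (ennreal (2 powr (- (?j * s))) * Linf_norm ?u)"
    by (simp add: powr_minus flip: mult.assoc ennreal_mult)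
  also have "\<dots> \<le> ennreal (2 powr (?j * s)) * ennreal B"
    using le by (rule mult_left_mono) simp
  finally have "Linf_norm ?u \<le> ennreal (2 powr (?j * s) * B)"
    by (simp add: B_def flip: ennreal_mult)
  moreover have "AE x in lebesgue. ennreal (norm (?u x)) \<le> Linf_norm ?u"
    unfolding Linf_norm_def by (rule esssup_AE)
  ultimately have "AE x in lebesgue. ennreal (norm (?u x)) \<le> ennreal (2 powr (?j * s) * B)"
    by (auto elim: eventually_mono intro: order_trans)
  then show ?thesis
    unfolding B_def by (auto elim!: eventually_mono)
qed

text \<open>
  With \<open>k = 1\<close> the exponent of \<open>2\<^sup>j\<close> is \<open>s (1 - 2/p) - 2/p\<close>, and with \<open>k = 2\<close> it is \<open>s (1 - 2/p) - 4/p\<close>. For the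
  admissible \<open>p\<close> the first is positive and the second negative. The constant \<open>16/9\<close> is \<open>(4/3)\<^sup>2\<close>, an upper bound for
  \<open>((4/3)\<^sup>k) powr (2/p)\<close> when \<open>k \<le> 2\<close> and \<open>p > 2\<close>.
\<close>

lemma LP_block_Lp_bound:
  fixes f :: "real^'n \<Rightarrow> complex"
  assumes dp: "dyadic_partition chi \<phi>" and f: "in_H k f" and k: "k \<le> 2"
    and fin: "besov_norm chi \<phi> (- s) f < \<infinity>" and p: "p > 2"
  defines "\<theta> \<equiv> 1 - 2 / p" and "B \<equiv> enn2real (besov_norm chi \<phi> (- s) f)"
  shows "in_Lp p (fourier_multiplier (LP_symbol chi \<phi> n) f)"
    and "Lp_norm p (fourier_multiplier (LP_symbol chi \<phi> n) f)
      \<le> 16 / 9 * B powr \<theta> * (2 powr ((real n - 1) * (s * \<theta> - 2 * real k / p)) * H_norm k f powr (2 / p))"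
proof -
  let ?u = "fourier_multiplier (LP_symbol chi \<phi> n) f"
  let ?j = "real n - 1"
  have B: "B \<ge> 0" and H: "H_norm k f \<ge> 0"
    by (simp_all add: B_def H_norm_def)
  note u2 = LP_block_L2_bound[OF dp f, of n]
  have uinf: "AE x in lebesgue. norm (?u x) \<le> 2 powr (?j * s) * B"
    using LP_block_Linf_bound[OF fin] by (simp add: B_def)
  have K: "0 \<le> 2 powr (?j * s) * B"
    using B by simp
  show "in_Lp p ?u"
    by (rule Lp_interpolation_2_infinity(1)[OF u2(1) uinf K p])
  have "Lp_norm p ?u \<le> (2 powr (?j * s) * B) powr \<theta> * Lp_norm 2 ?u powr (2 / p)"
    unfolding \<theta>_def by (rule Lp_interpolation_2_infinity(2)[OF u2(1) uinf K p])
  also have "\<dots> \<le> (2 powr (?j * s) * B) powr \<theta> *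
      ((4 / 3) ^ k * 2 powr (- (real k * ?j)) * H_norm k f) powr (2 / p)"
    using u2(2) p by (intro mult_left_mono powr_mono2) (simp_all add: Lp_norm_nonneg)
  also have "\<dots> = ((4 / 3) ^ k) powr (2 / p) * (B powr \<theta> * (2 powr (?j * s * \<theta>) * 2 powr (- (real k * ?j) * (2 / p)) * H_norm k f powr (2 / p)))"
    using B H by (simp add: powr_mult powr_powr mult_ac)
  also have "2 powr (?j * s * \<theta>) * 2 powr (- (real k * ?j) * (2 / p)) = 2 powr (?j * (s * \<theta> - 2 * real k / p))"
    unfolding powr_add[symmetric] by (rule arg_cong[where f = "(powr) 2"]) (simp add: algebra_simps add_divide_distrib diff_divide_distrib)
  also have "((4 / 3) ^ k) powr (2 / p) * (B powr \<theta> * (2 powr (?j * (s * \<theta> - 2 * real k / p)) * H_norm k f powr (2 / p)))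
      \<le> 16 / 9 * (B powr \<theta> * (2 powr (?j * (s * \<theta> - 2 * real k / p)) * H_norm k f powr (2 / p)))"
  proof (rule mult_right_mono)
    have "((4 / 3 :: real) ^ k) powr (2 / p) \<le> ((4 / 3) ^ k) powr 1"
      using p by (intro powr_mono) simp_all
    also have "\<dots> = (4 / 3) ^ k"
      by simp
    also have "\<dots> \<le> (4 / 3 :: real) ^ 2"
      using k by (intro power_increasing) simp_all
    finally show "((4 / 3 :: real) ^ k) powr (2 / p) \<le> 16 / 9"
      by (simp add: power2_eq_square)
  qed simp
  finally show "Lp_norm p ?u \<le> 16 / 9 * B powr \<theta> * (2 powr (?j * (s * \<theta> - 2 * real k / p)) * H_norm k f powr (2 / p))"
    by (simp add: mult.assoc)
qed

section \<open>Summing over the blocks\<close>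

text \<open>
  The growing bound is used for the blocks with \<open>2\<^sup>j \<le> H2 / H1\<close> and the decaying one for the others. Both geometric
  sums are dominated by their terms at the crossover, where the two bounds have the common size
  \<open>H1 powr b * H2 powr a\<close>.
\<close>

lemma two_sided_geometric_sum_le:
  fixes A :: "nat \<Rightarrow> real" and a b H1 H2 D :: real
  assumes a: "0 < a" "a \<le> 1" and b: "b > 0" and H: "0 < H1" "H1 \<le> H2" and D: "D \<ge> 0"
    and A1: "\<And>n. A n \<le> D * (2 powr ((real n - 1) * a) * H1 powr (a + b))"
    and A2: "\<And>n. A n \<le> D * (2 powr (- (real n - 1) * b) * H2 powr (a + b))"
  shows "(\<Sum>n<N. A n) \<le> D * (2 / (2 powr a - 1) + 1 / (1 - 2 powr (- b))) * (H1 powr b * H2 powr a)"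
proof -
  define q r where "q = 2 powr a" and "r = 2 powr (- b)"
  have q: "q > 1" "q \<le> 2"
    using a powr_mono[of a 1 "2 :: real"] by (auto simp: q_def)
  have r: "0 < r" "r < 1"
    using b powr_less_mono[of "- b" 0 "2 :: real"] by (auto simp: r_def)
  define R where "R = H2 / H1"
  have R: "R \<ge> 1"
    using H by (simp add: R_def)
  define L where "L = log 2 R"
  have L: "L \<ge> 0" and RL: "2 powr L = R"
    using R by (auto simp: L_def)
  \<comment> \<open>The indices \<open>n \<le> M\<close> are those with \<open>n - 1 \<le> L\<close>, that is, with \<open>2 powr (n - 1) \<le> R\<close>.\<close>
  define M where "M = nat \<lfloor>L\<rfloor> + 1"
  have M: "real M - 1 \<le> L" "L \<le> real M"
    using L by (auto simp: M_def) linarith+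
  have R_H: "R powr a * H1 powr (a + b) = H1 powr b * H2 powr a"
    "R powr (- b) * H2 powr (a + b) = H1 powr b * H2 powr a"
    using H by (simp_all add: R_def powr_divide powr_add powr_minus field_simps)
  have head: "(\<Sum>n<Suc M. 2 powr ((real n - 1) * a)) \<le> 2 / (q - 1) * R powr a"
  proof -
    have "(\<Sum>n<Suc M. 2 powr ((real n - 1) * a)) = (\<Sum>n<Suc M. q ^ n / q)"
    proof (rule sum.cong)
      fix n :: nat
      have "(real n - 1) * a = a * real n - a"
        by (simp add: algebra_simps)
      then show "2 powr ((real n - 1) * a) = q ^ n / q"
        by (simp add: q_def powr_diff powr_powr flip: powr_realpow)
    qed simp
    also have "\<dots> = (\<Sum>n<Suc M. q ^ n) / q"
      by (rule sum_divide_distrib[symmetric])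
    also have "\<dots> = (q ^ Suc M - 1) / (q - 1) / q"
      using q by (subst geometric_sum) auto
    also have "\<dots> \<le> q ^ Suc M / (q - 1) / q"
      using q by (intro divide_right_mono) auto
    also have "\<dots> = q ^ M / (q - 1)"
      using q by simp
    also have "\<dots> \<le> 2 * R powr a / (q - 1)"
    proof (rule divide_right_mono)
      have "q ^ M = 2 powr (real M * a)"
        by (simp add: q_def powr_powr mult.commute flip: powr_realpow)
      also have "\<dots> \<le> 2 powr (a + L * a)"
        using M(1) a by (intro powr_mono) (auto simp: algebra_simps dest: mult_right_mono[of _ _ a])
      also have "\<dots> = q * R powr a"
        by (simp add: powr_add q_def powr_powr flip: RL)
      also have "\<dots> \<le> 2 * R powr a"
        using q by (intro mult_right_mono) auto
      finally show "q ^ M \<le> 2 * R powr a" .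
    qed (use q in simp)
    finally show ?thesis by simp
  qed
  have tail: "(\<Sum>n\<in>{Suc M..<Suc M + N}. 2 powr (- (real n - 1) * b)) \<le> 1 / (1 - r) * R powr (- b)"
  proof -
    have "(\<Sum>n\<in>{Suc M..<Suc M + N}. 2 powr (- (real n - 1) * b)) = (\<Sum>n<N. 2 powr (- (real (n + Suc M) - 1) * b))"
      by (rule sum.reindex_bij_witness[of _ "\<lambda>n. n + Suc M" "\<lambda>n. n - Suc M"]) auto
    also have "\<dots> = (\<Sum>n<N. r ^ M * r ^ n)"
    proof (rule sum.cong)
      fix n
      have "- (real (n + Suc M) - 1) * b = real (M + n) * (- b)"
        by (simp add: algebra_simps)
      then show "2 powr (- (real (n + Suc M) - 1) * b) = r ^ M * r ^ n"
        unfolding r_def power_add[symmetric] by (simp add: powr_powr mult.commute flip: powr_realpow)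
    qed simp
    also have "\<dots> = r ^ M * ((1 - r ^ N) / (1 - r))"
      using r by (simp add: sum_gp_strict flip: sum_distrib_left)
    also have "\<dots> \<le> R powr (- b) * (1 / (1 - r))"
    proof (rule mult_mono)
      have "r ^ M = 2 powr (- (real M * b))"
        by (simp add: r_def powr_powr mult.commute flip: powr_realpow)
      also have "\<dots> \<le> 2 powr (L * (- b))"
        using M(2) b by (intro powr_mono) (auto simp: mult_right_mono)
      also have "\<dots> = R powr (- b)"
        by (simp add: powr_powr flip: RL)
      finally show "r ^ M \<le> R powr (- b)" .
      show "(1 - r ^ N) / (1 - r) \<le> 1 / (1 - r)"
        using r by (intro divide_right_mono) auto
      show "0 \<le> (1 - r ^ N) / (1 - r)"
        using r by (simp add: power_le_one)
    qed simp
    finally show ?thesis by (simp add: mult.commute)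
  qed
  define F where "F n = (if n < Suc M then D * (2 powr ((real n - 1) * a) * H1 powr (a + b))
      else D * (2 powr (- (real n - 1) * b) * H2 powr (a + b)))" for n
  have "(\<Sum>n<N. A n) \<le> (\<Sum>n<N. F n)"
    by (intro sum_mono) (simp only: F_def A1 A2 split: if_split, simp)
  also have "\<dots> \<le> (\<Sum>n<Suc M + N. F n)"
    by (rule sum_mono2) (use D in \<open>auto simp: F_def\<close>)
  also have "\<dots> = (\<Sum>n<Suc M. F n) + (\<Sum>n\<in>{Suc M..<Suc M + N}. F n)"
    unfolding lessThan_atLeast0 by (rule sum.atLeastLessThan_concat[symmetric]) simp_all
  also have "(\<Sum>n<Suc M. F n) = D * ((\<Sum>n<Suc M. 2 powr ((real n - 1) * a)) * H1 powr (a + b))"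
    unfolding sum_distrib_right sum_distrib_left by (intro sum.cong) (auto simp: F_def)
  also have "(\<Sum>n\<in>{Suc M..<Suc M + N}. F n)
      = D * ((\<Sum>n\<in>{Suc M..<Suc M + N}. 2 powr (- (real n - 1) * b)) * H2 powr (a + b))"
    unfolding sum_distrib_right sum_distrib_left by (intro sum.cong) (auto simp: F_def)
  also have "D * ((\<Sum>n<Suc M. 2 powr ((real n - 1) * a)) * H1 powr (a + b)) +
      D * ((\<Sum>n\<in>{Suc M..<Suc M + N}. 2 powr (- (real n - 1) * b)) * H2 powr (a + b))
      \<le> D * (2 / (q - 1) * R powr a * H1 powr (a + b)) + D * (1 / (1 - r) * R powr (- b) * H2 powr (a + b))"
    by (intro add_mono mult_left_mono mult_right_mono head tail D) simp_all
  also have "\<dots> = D * (2 / (q - 1) + 1 / (1 - r)) * (H1 powr b * H2 powr a)"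
    unfolding mult.assoc R_H by (simp add: algebra_simps)
  finally show ?thesis
    by (simp add: q_def r_def)
qed

text \<open>
  For the orders \<open>1\<close> and \<open>2\<close>, it places the crossover frequency of \<open>two_sided_geometric_sum_le\<close> at one or above.
\<close>

lemma in_H_H_norm_mono:
  fixes f :: "real^'n \<Rightarrow> complex"
  assumes f: "in_H k f" and "l \<le> k"
  shows "in_H l f" and "H_norm l f \<le> H_norm k f"
proof -
  have f2: "in_Lp 2 f" and int: "integrable lebesgue (\<lambda>\<xi>. (1 + (norm \<xi>)\<^sup>2) ^ k * (norm (fourier_L2 f \<xi>))\<^sup>2)"
    using f by (auto simp: in_H_def)
  have [measurable]: "fourier_L2 f \<in> borel_measurable lebesgue"
    using in_Lp_fourier_L2[OF f2] by (auto simp: in_Lp_def)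
  have [measurable]: "(\<lambda>\<xi>. (1 + (norm \<xi>)\<^sup>2) ^ l) \<in> borel_measurable (lebesgue :: (real^'n) measure)"
    by (intro borel_measurable_lebesgue_continuous continuous_intros)
  have le: "(1 + (norm \<xi>)\<^sup>2) ^ l * (norm (fourier_L2 f \<xi>))\<^sup>2 \<le> (1 + (norm \<xi>)\<^sup>2) ^ k * (norm (fourier_L2 f \<xi>))\<^sup>2" for \<xi>
    using \<open>l \<le> k\<close> by (intro mult_right_mono power_increasing) auto
  have int': "integrable lebesgue (\<lambda>\<xi>. (1 + (norm \<xi>)\<^sup>2) ^ l * (norm (fourier_L2 f \<xi>))\<^sup>2)"
    by (rule Bochner_Integration.integrable_bound[OF int]) (use le in auto)
  then show "in_H l f"
    using f2 by (simp add: in_H_def)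
  show "H_norm l f \<le> H_norm k f"
    unfolding H_norm_def by (intro real_sqrt_le_mono integral_mono int int' le)
qed

text \<open>
  Guarantees that the \<open>H\<^sup>1\<close> norm of a nonzero function is positive, so that the crossover frequency makes sense.
\<close>

lemma L2_norm_le_H_norm:
  fixes f :: "real^'n \<Rightarrow> complex"
  assumes f: "in_H k f"
  shows "Lp_norm 2 f \<le> H_norm k f"
proof -
  have f2: "in_Lp 2 f"
    using f by (simp add: in_H_def)
  have "Lp_norm 2 (\<lambda>x. inv_fourier_L1 (\<lambda>_. 0) x - f x) \<le> Lp_norm 2 (\<lambda>\<xi>. 0 - fourier_L2 f \<xi>)"
    by (rule inv_fourier_L1_approx) (use f2 in \<open>simp_all add: in_Lp_def\<close>)
  then have "Lp_norm 2 f \<le> Lp_norm 2 (fourier_L2 f)"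
    by (simp add: inv_fourier_L1_def Lp_norm_uminus)
  also have "\<dots> = H_norm 0 f"
    unfolding H_norm_def by (simp add: Lp_norm_nonneg flip: Lp_norm_2_power2)
  also have "\<dots> \<le> H_norm k f"
    by (rule in_H_H_norm_mono(2)[OF f]) simp
  finally show ?thesis .
qed

lemma Lp_norm_eq_0_imp_AE:
  assumes "p > 0" "in_Lp p f" "Lp_norm p f = 0"
  shows "AE x in lebesgue. f x = 0"
proof -
  have [measurable]: "f \<in> borel_measurable lebesgue"
    using assms by (auto simp: in_Lp_def)
  have "(\<integral>\<^sup>+x. ennreal (norm (f x) powr p) \<partial>lebesgue) = 0"
    using assms by (simp add: nn_integral_powr_eq_Lp_norm)
  then have "AE x in lebesgue. ennreal (norm (f x) powr p) = 0"
    by (subst (asm) nn_integral_0_iff_AE) measurable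
  then show ?thesis
    by (auto elim!: eventually_mono simp: ennreal_eq_0_iff)
qed

text \<open>
  The partial sums of the symbols lie between \<open>0\<close> and \<open>1\<close> and tend to \<open>1\<close>, so the cut-off transforms converge to the
  transform of \<open>f\<close> by dominated convergence.
\<close>

lemma LP_partial_sums_converge_L2:
  fixes f :: "real^'n \<Rightarrow> complex"
  assumes dp: "dyadic_partition chi \<phi>" and f: "in_Lp 2 f"
  shows "(\<lambda>N. Lp_norm 2 (\<lambda>x. (\<Sum>n<N. fourier_multiplier (LP_symbol chi \<phi> n) f x) - f x)) \<longlonglongrightarrow> 0"
proof -
  let ?m = "LP_symbol chi \<phi>"
  let ?g = "fourier_L2 f"
  define v where "v n \<xi> = complex_of_real (?m n \<xi>) * ?g \<xi>" for n \<xi>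
  define V where "V N \<xi> = (\<Sum>n<N. v n \<xi>)" for N \<xi>
  have g: "in_Lp 2 ?g"
    by (rule in_Lp_fourier_L2[OF f])
  have [measurable]: "?g \<in> borel_measurable lebesgue"
    using g by (auto simp: in_Lp_def)
  have [measurable]: "?m n \<in> borel_measurable lebesgue" for n
    by (rule measurable_LP_symbol[OF dp])
  have m: "\<bar>?m n \<xi>\<bar> \<le> 1" for n \<xi>
    using LP_symbol_le_1[OF dp] LP_symbol_nonneg[OF dp] by simp
  have v: "in_Lp 2 (v n)" "integrable lebesgue (v n)" for n
    using multiplier_symbol_integrable[OF measurable_LP_symbol[OF dp] m LP_symbol_support(1)[OF dp] g]
    unfolding v_def[abs_def] by blast+
  have V: "in_Lp 2 (V N)" "integrable lebesgue (V N)" for N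
    using Lp_norm_sum[of 2 "{..<N}" v] v unfolding V_def[abs_def] by auto
  have V_eq: "V N \<xi> - ?g \<xi> = complex_of_real ((\<Sum>n<N. ?m n \<xi>) - 1) * ?g \<xi>" for N \<xi>
    by (simp add: V_def v_def sum_distrib_right left_diff_distrib)
  have [measurable]: "V N \<in> borel_measurable lebesgue" for N
    using V(1) by (simp add: in_Lp_def)
  have "(\<Sum>n<N. fourier_multiplier (?m n) f x) = inv_fourier_L1 (V N) x" for N x
    unfolding V_def[abs_def]
    by (subst inv_fourier_L1_sum) (auto simp: v fourier_multiplier_def v_def[abs_def] intro!: v[unfolded v_def[abs_def]])
  then have le: "Lp_norm 2 (\<lambda>x. (\<Sum>n<N. fourier_multiplier (?m n) f x) - f x) \<le> Lp_norm 2 (\<lambda>\<xi>. V N \<xi> - ?g \<xi>)" for N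
    using inv_fourier_L1_approx[OF V(2) V(1) f] by simp
  have "(\<lambda>N. \<integral>\<xi>. (norm (V N \<xi> - ?g \<xi>))\<^sup>2 \<partial>lebesgue) \<longlonglongrightarrow> (\<integral>\<xi>. (0 :: real) \<partial>(lebesgue :: (real^'n) measure))"
  proof (rule integral_dominated_convergence[where w = "\<lambda>\<xi>. (norm (?g \<xi>))\<^sup>2"])
    show "integrable lebesgue (\<lambda>\<xi>. (norm (?g \<xi>))\<^sup>2)"
      using g by (simp add: in_Lp_2_iff)
    show "AE \<xi> in lebesgue. norm ((norm (V N \<xi> - ?g \<xi>))\<^sup>2) \<le> (norm (?g \<xi>))\<^sup>2" for N
    proof (rule AE_I2)
      fix \<xi>
      have "\<bar>(\<Sum>n<N. ?m n \<xi>) - 1\<bar> \<le> 1"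
        using LP_symbol_sum_le_1[OF dp, where N = N and \<xi> = \<xi>] sum_nonneg[of "{..<N}" "\<lambda>n. ?m n \<xi>"] LP_symbol_nonneg[OF dp]
        by fastforce
      then have "norm (V N \<xi> - ?g \<xi>) \<le> norm (?g \<xi>)"
        unfolding V_eq norm_mult norm_of_real by (simp add: mult_left_le_one_le)
      then show "norm ((norm (V N \<xi> - ?g \<xi>))\<^sup>2) \<le> (norm (?g \<xi>))\<^sup>2"
        by (simp add: power_mono)
    qed
    show "AE \<xi> in lebesgue. (\<lambda>N. (norm (V N \<xi> - ?g \<xi>))\<^sup>2) \<longlonglongrightarrow> 0"
    proof (rule AE_I2)
      fix \<xi>
      have "(\<lambda>N. \<Sum>n<N. ?m n \<xi>) \<longlonglongrightarrow> 1"
        using LP_symbol_sums_1[OF dp, of \<xi>] by (simp add: sums_def)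
      then have "(\<lambda>N. (norm (complex_of_real ((\<Sum>n<N. ?m n \<xi>) - 1) * ?g \<xi>))\<^sup>2)
          \<longlonglongrightarrow> (norm (complex_of_real (1 - 1) * ?g \<xi>))\<^sup>2"
        by (intro tendsto_intros)
      then show "(\<lambda>N. (norm (V N \<xi> - ?g \<xi>))\<^sup>2) \<longlonglongrightarrow> 0"
        by (simp add: V_eq)
    qed
  qed simp_all
  from tendsto_real_sqrt[OF this] have lim: "(\<lambda>N. Lp_norm 2 (\<lambda>\<xi>. V N \<xi> - ?g \<xi>)) \<longlonglongrightarrow> 0"
    by (simp add: Lp_norm_nonneg flip: Lp_norm_2_power2)
  show ?thesis
    by (rule tendsto_sandwich[OF _ _ tendsto_const lim]) (simp_all add: le Lp_norm_nonneg)
qed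

section \<open>The interpolation inequality\<close>

theorem lemma2p2:
  fixes chi \<phi> :: "real^'n \<Rightarrow> real"
  assumes "dyadic_partition chi \<phi>"
  shows "\<exists>C::real. C > 0 \<and>
    (\<forall>(s::real) (f :: real^'n \<Rightarrow> complex) (p::real).
       s > 0 \<longrightarrow>
       in_H 2 f \<longrightarrow> besov_norm chi \<phi> (- s) f < \<infinity> \<longrightarrow>
       \<not> (AE x in lebesgue. f x = 0) \<longrightarrow>
       2 + 2 / s < p \<longrightarrow> p < 2 + 4 / s \<longrightarrow>
       in_Lp p f \<and>
       Lp_norm p f \<le>
         C * max (1 / (2 powr (s * (1 - 2 / p) - 2 / p) - 1))
                 (1 / (1 - 2 powr (s * (1 - 2 / p) - 4 / p))) *
         enn2real (besov_norm chi \<phi> (- s) f) powr (1 - 2 / p) *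
         H_norm 1 f powr (4 / p - s * (1 - 2 / p)) *
         H_norm 2 f powr (s * (1 - 2 / p) - 2 / p))"
\<comment> \<open>\<open>16/3 = 16/9 \<cdot> (2 + 1)\<close>: the block constant times the numerators of the two geometric sums.\<close>
proof (rule exI[of _ "16 / 3"], intro conjI allI impI)
  fix s p :: real and f :: "real^'n \<Rightarrow> complex"
  assume s: "s > 0" and f: "in_H 2 f" and fin: "besov_norm chi \<phi> (- s) f < \<infinity>"
    and nz: "\<not> (AE x in lebesgue. f x = 0)" and p1: "2 + 2 / s < p" and p2: "p < 2 + 4 / s"
  note dp = assms
  define a b B where "a = s * (1 - 2 / p) - 2 / p" and "b = 4 / p - s * (1 - 2 / p)"
    and "B = enn2real (besov_norm chi \<phi> (- s) f)"
  define H1 H2 where "H1 = H_norm 1 f" and "H2 = H_norm 2 f"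
  define mx where "mx = max (1 / (2 powr a - 1)) (1 / (1 - 2 powr (- b)))"
  let ?u = "\<lambda>n. fourier_multiplier (LP_symbol chi \<phi> n) f"
  have p: "p > 2"
    using p1 s by (smt (verit) divide_pos_pos)
  have "2 < s * (p - 2)" "s * (p - 2) < 4"
    using p1 p2 s by (simp_all add: field_simps)
  moreover have "a = (s * (p - 2) - 2) / p" "b = (4 - s * (p - 2)) / p"
    using p by (simp_all add: a_def b_def field_simps)
  ultimately have a: "a > 0" and b: "b > 0"
    using p by simp_all
  have ab: "a + b = 2 / p"
    by (simp add: a_def b_def)
  have "2 / p \<le> 1"
    using p by simp
  then have a1: "a \<le> 1"
    using ab b by linarith
  have f2: "in_Lp 2 f"
    using f by (simp add: in_H_def)
  have f1: "in_H 1 f" and H12: "H1 \<le> H2"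
    using in_H_H_norm_mono[OF f, of 1] by (simp_all add: H1_def H2_def)
  have "Lp_norm 2 f \<noteq> 0"
    using Lp_norm_eq_0_imp_AE[OF _ f2] nz by auto
  then have H1: "H1 > 0"
    using L2_norm_le_H_norm[OF f1] Lp_norm_nonneg[of 2 f] by (simp add: H1_def)
  have up: "in_Lp p (?u n)" for n
    using LP_block_Lp_bound(1)[OF dp f _ fin p] by simp
  define D where "D = 16 / 9 * B powr (1 - 2 / p)"
  have D: "D \<ge> 0"
    by (simp add: D_def)
  have A1: "Lp_norm p (?u n) \<le> D * (2 powr ((real n - 1) * a) * H1 powr (a + b))" for n
    using LP_block_Lp_bound(2)[OF dp f1 _ fin p, of n] unfolding D_def B_def H1_def ab by (simp add: a_def)
  have A2: "Lp_norm p (?u n) \<le> D * (2 powr (- (real n - 1) * b) * H2 powr (a + b))" for n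
  proof -
    have "(real n - 1) * (s * (1 - 2 / p) - 2 * real 2 / p) = - (real n - 1) * b"
      by (simp add: b_def algebra_simps add_divide_distrib diff_divide_distrib)
    then show ?thesis
      using LP_block_Lp_bound(2)[OF dp f _ fin p, of n] unfolding D_def B_def H2_def ab by simp
  qed
  define E where "E = D * (2 / (2 powr a - 1) + 1 / (1 - 2 powr (- b))) * (H1 powr b * H2 powr a)"
  have sum_le: "(\<Sum>n<N. Lp_norm p (?u n)) \<le> E" for N
    unfolding E_def by (rule two_sided_geometric_sum_le[OF a a1 b H1 H12 D A1 A2])
  have S: "in_Lp p (\<lambda>x. \<Sum>n<N. ?u n x)" "Lp_norm p (\<lambda>x. \<Sum>n<N. ?u n x) \<le> E" for N
    using Lp_norm_sum[of p "{..<N}" ?u] up p sum_le[of N] by auto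
  have S2: "in_Lp 2 (\<lambda>x. (\<Sum>n<N. ?u n x) - f x)" for N
    using Lp_norm_sum[of 2 "{..<N}" ?u] LP_block_L2_bound(1)[OF dp f] by (intro Lp_norm_diff(1)[OF _ _ f2]) auto
  obtain \<rho> :: "nat \<Rightarrow> nat" where "AE x in lebesgue. (\<lambda>i. (\<Sum>n<\<rho> i. ?u n x) - f x) \<longlonglongrightarrow> 0"
    using L2_null_imp_AE_subseq[OF S2 LP_partial_sums_converge_L2[OF dp f2]] by blast
  then have lim: "AE x in lebesgue. (\<lambda>i. \<Sum>n<\<rho> i. ?u n x) \<longlonglongrightarrow> f x"
    by eventually_elim (simp add: LIM_zero_cancel)
  have fm: "f \<in> borel_measurable lebesgue"
    using f2 by (simp add: in_Lp_def)
  have p0: "p > 0"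
    using p by simp
  show "in_Lp p f"
    by (rule Lp_norm_Fatou(1)[OF p0 S lim fm])
  have "Lp_norm p f \<le> E"
    by (rule Lp_norm_Fatou(2)[OF p0 S lim fm])
  also have "E \<le> D * (3 * mx) * (H1 powr b * H2 powr a)"
    unfolding E_def
  proof (intro mult_right_mono mult_left_mono D)
    have "1 / (2 powr a - 1) \<le> mx" "1 / (1 - 2 powr (- b)) \<le> mx"
      by (simp_all add: mx_def)
    then show "2 / (2 powr a - 1) + 1 / (1 - 2 powr (- b)) \<le> 3 * mx"
      by simp
  qed simp
  also have "\<dots> = 16 / 3 * mx * B powr (1 - 2 / p) * H1 powr b * H2 powr a"
    by (simp add: D_def)
  finally show "Lp_norm p f \<le> 16 / 3 * max (1 / (2 powr (s * (1 - 2 / p) - 2 / p) - 1))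
                 (1 / (1 - 2 powr (s * (1 - 2 / p) - 4 / p))) *
         enn2real (besov_norm chi \<phi> (- s) f) powr (1 - 2 / p) *
         H_norm 1 f powr (4 / p - s * (1 - 2 / p)) *
         H_norm 2 f powr (s * (1 - 2 / p) - 2 / p)"
    unfolding mx_def a_def b_def B_def H1_def H2_def by simp
qed simp

end
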